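(* Suppose that the feasibility condition holds, i.e. there exists $H\in\mathbb{R}^{m\times n}$ such that $I-AA^\top=BH+H^\top B^\top$. Then the problem of minimizing $J_\Psi(\Lambda)$ over $\mathcal{L}_+^\Gamma$ admits a unique solution $\Lambda^\circ\in\mathcal{L}_+^\Gamma$.
   Context: $\mathbb{T}$ is the unit circle; $\int$ denotes integration over $\mathbb{T}$ with respect to normalized Lebesgue measure; $^*$ denotes conjugate transpose on $\mathbb{T}$. $\mathcal{S}_+^{m\times m}$ is the family of bounded and coercive spectral densities on $\mathbb{T}$ of $\mathbb{R}^m$-valued stationary processes (coercive: $\Phi\ge\alpha I_m$ a.e. for some $\alpha>0$). $\Psi\in\mathcal{S}_+^{m\times m}$ is fixed. $G(z)=(zI-A)^{-1}B$, where $A\in\mathbb{R}^{n\times n}$ has all eigenvalues in the open unit disc, $B\in\mathbb{R}^{n\times m}$ has full rank, $n\ge m$, and $(A,B)$ is reachable. $W_\Psi$ is the stable, minimum phase spectral factor of $\Psi$ ($\Psi=W_\Psi W_\Psi^*$), and $G_1:=GW_\Psi$. $\Gamma(\Phi):=\int G\Phi G^*$ is the linear map from the real linear span of the continuous spectral densities on $\mathbb{T}$ of $\mathbb{R}^m$-valued processes to the space of real symmetric $n\times n$ matrices; $\mathrm{Range}(\Gamma)$ is its range. Further, $$\mathcal{L}_+^\Gamma:=\{\Lambda\in\mathrm{Range}(\Gamma):\ I+G_1^*\Lambda G_1>0\ \text{a.e. on }\mathbb{T}\},\qquad J_\Psi(\Lambda):=\int\left[\operatorname{tr}\Lambda-\log\det(I+G_1^*\Lambda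 G_1)\right],$$ where the integral is understood with values in $(-\infty,+\infty]$. The covariance $\Sigma$ of the underlying constraint $\int G\Phi G^*=\Sigma$ is normalized to $\Sigma=I$, as in the paper. *)

theory Defs
  imports "HOL-Analysis.Analysis"
begin

section \<open>Normalized Lebesgue measure on the unit circle\<close>

text \<open>The measure lives on the whole complex plane and is complete; the complement of the unit
  circle is a null set, so only the values of a function on the circle matter.\<close>

definition circle_measure :: "complex measure" where
  "circle_measure = completion (distr (uniform_measure lborel {0..2 * pi}) borel cis)"

text \<open>The integral with values in the extended reals: integral of the positive part minus integral
  of the negative part (\<^const>\<open>ennreal\<close> maps negative reals to 0).  It is meaningful
  whenever one of the two parts is finite.\<close>

definition ext_integral :: "'a measure \<Rightarrow> ('a \<Rightarrow> real) \<Rightarrow> ereal" where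
  "ext_integral M f =
     enn2ereal (\<integral>\<^sup>+ x. ennreal (f x) \<partial>M) - enn2ereal (\<integral>\<^sup>+ x. ennreal (- f x) \<partial>M)"

section \<open>Complex matrices\<close>

abbreviation cmat :: "real^'n^'m \<Rightarrow> complex^'n^'m" where
  "cmat \<equiv> map_matrix complex_of_real"

definition ctranspose :: "complex^'n^'m \<Rightarrow> complex^'m^'n" where
  "ctranspose M = map_matrix cnj (transpose M)"

definition hermitian :: "complex^'n^'n \<Rightarrow> bool" where
  "hermitian M \<longleftrightarrow> ctranspose M = M"

text \<open>The real inner product of \<open>v\<close> and \<open>M *v v\<close> is the real part of
  \<open>v\<^sup>* M v\<close>, which is \<open>v\<^sup>* M v\<close> itself for Hermitian \<open>M\<close>.\<close>

definition psd :: "complex^'n^'n \<Rightarrow> bool" where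
  "psd M \<longleftrightarrow> hermitian M \<and> (\<forall>v. 0 \<le> v \<bullet> (M *v v))"

definition posdef :: "complex^'n^'n \<Rightarrow> bool" where
  "posdef M \<longleftrightarrow> hermitian M \<and> (\<forall>v. v \<noteq> 0 \<longrightarrow> 0 < v \<bullet> (M *v v))"

section \<open>Spectral densities of real vector-valued stationary processes\<close>

text \<open>The last conjunct expresses that the process is real-valued (its covariances are real).\<close>

definition spectral_density :: "(complex \<Rightarrow> complex^'m^'m) \<Rightarrow> bool" where
  "spectral_density \<Phi> \<longleftrightarrow>
     integrable circle_measure \<Phi> \<and>
     (AE z in circle_measure. psd (\<Phi> z)) \<and>
     (AE z in circle_measure. \<Phi> (cnj z) = map_matrix cnj (\<Phi> z))"

definition bounded_coercive_density :: "(complex \<Rightarrow> complex^'m^'m) \<Rightarrow> bool" where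
  "bounded_coercive_density \<Phi> \<longleftrightarrow>
     spectral_density \<Phi> \<and>
     (\<exists>K. AE z in circle_measure. norm (\<Phi> z) \<le> K) \<and>
     (\<exists>\<alpha>>0. AE z in circle_measure. psd (\<Phi> z - \<alpha> *\<^sub>R mat 1))"

definition cont_densities :: "(complex \<Rightarrow> complex^'m^'m) set" where
  "cont_densities = {\<Phi>. spectral_density \<Phi> \<and> continuous_on (sphere 0 1) \<Phi>}"

definition cont_density_span :: "(complex \<Rightarrow> complex^'m^'m) set" where
  "cont_density_span =
     {\<lambda>z. \<Sum>i<k. c i *\<^sub>R \<Phi> i z | (k::nat) (c :: nat \<Rightarrow> real) \<Phi>. \<forall>i<k. \<Phi> i \<in> cont_densities}"

section \<open>The stable, minimum phase spectral factor\<close>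

text \<open>Since \<open>(zI - A)\<^sup>-\<^sup>1 B\<close> with stable \<open>A\<close> is analytic outside the open
  disc, so is every stable function here: it is a bounded analytic function on the exterior of the
  closed disc (hence also analytic at infinity), and its values on the circle are its radial
  boundary values.  Minimum phase means that the inverse is stable too.  For a bounded and coercive
  density the square-integrable outer factors are bounded with bounded inverse, so requiring
  boundedness excludes none of them.

  The factor is determined only up to a constant unitary factor on the right, on which neither
  the feasible set nor the functional below depends; no normalization is imposed.\<close>

definition stable_function :: "(complex \<Rightarrow> complex^'m^'m) \<Rightarrow> bool" where
  "stable_function F \<longleftrightarrow>
     (\<forall>i j. (\<lambda>z. F z $ i $ j) holomorphic_on {z. 1 < norm z}) \<and>
     bounded (F ` {z. 1 < norm z}) \<and>
     (AE z in circle_measure. ((\<lambda>r. F (complex_of_real r * z)) \<longlongrightarrow> F z) (at_right 1))"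

definition stable_min_phase_factor ::
    "(complex \<Rightarrow> complex^'m^'m) \<Rightarrow> (complex \<Rightarrow> complex^'m^'m) \<Rightarrow> bool" where
  "stable_min_phase_factor W \<Psi> \<longleftrightarrow>
     (AE z in circle_measure. \<Psi> z = W z ** ctranspose (W z)) \<and>
     stable_function W \<and>
     (\<forall>z. 1 < norm z \<longrightarrow> invertible (W z)) \<and>
     stable_function (\<lambda>z. matrix_inv (W z))"

section \<open>The linear system\<close>

definition stable_matrix :: "real^'n^'n \<Rightarrow> bool" where
  "stable_matrix A \<longleftrightarrow>
     (\<forall>(\<mu>::complex) v. v \<noteq> 0 \<and> cmat A *v v = \<mu> *s v \<longrightarrow> norm \<mu> < 1)"

text \<open>The columns of \<open>B, AB, \<dots>, A\<^sup>n\<^sup>-\<^sup>1B\<close> span the state space.  (The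
  library's power operation on matrices would be taken entrywise, hence the iteration.)\<close>

definition reachable :: "real^'n^'n \<Rightarrow> real^'m^'n \<Rightarrow> bool" where
  "reachable A B \<longleftrightarrow> span (\<Union>k<CARD('n). columns ((((**) A) ^^ k) B)) = UNIV"

definition transfer_fn :: "real^'n^'n \<Rightarrow> real^'m^'n \<Rightarrow> complex \<Rightarrow> complex^'m^'n" where
  "transfer_fn A B z = matrix_inv (mat z - cmat A) ** cmat B"

definition Gamma_op ::
    "real^'n^'n \<Rightarrow> real^'m^'n \<Rightarrow> (complex \<Rightarrow> complex^'m^'m) \<Rightarrow> complex^'n^'n" where
  "Gamma_op A B \<Phi> =
     (LINT z|circle_measure. transfer_fn A B z ** \<Phi> z ** ctranspose (transfer_fn A B z))"

text \<open>The integral is a complex matrix with real entries on the span of the continuous densities;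
  its range is taken as a set of real matrices.\<close>

definition range_Gamma :: "real^'n^'n \<Rightarrow> real^'m^'n \<Rightarrow> (real^'n^'n) set" where
  "range_Gamma A B = {\<Lambda>. cmat \<Lambda> \<in> Gamma_op A B ` cont_density_span}"

section \<open>The dual problem\<close>

text \<open>The matrix \<open>I + G\<^sub>1\<^sup>* \<Lambda> G\<^sub>1\<close> with \<open>G\<^sub>1 = G W\<close>.\<close>

definition dual_matrix ::
    "real^'n^'n \<Rightarrow> real^'m^'n \<Rightarrow> (complex \<Rightarrow> complex^'m^'m) \<Rightarrow> real^'n^'n \<Rightarrow> complex \<Rightarrow> complex^'m^'m"
  where
  "dual_matrix A B W \<Lambda> z =
     (let G1 = transfer_fn A B z ** W z in mat 1 + ctranspose G1 ** cmat \<Lambda> ** G1)"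

definition dual_set ::
    "real^'n^'n \<Rightarrow> real^'m^'n \<Rightarrow> (complex \<Rightarrow> complex^'m^'m) \<Rightarrow> (real^'n^'n) set" where
  "dual_set A B W =
     {\<Lambda> \<in> range_Gamma A B. AE z in circle_measure. posdef (dual_matrix A B W \<Lambda> z)}"

text \<open>On the feasible set the determinant is a positive real number almost everywhere, so taking its
  real part loses nothing.\<close>

definition dual_fun ::
    "real^'n^'n \<Rightarrow> real^'m^'n \<Rightarrow> (complex \<Rightarrow> complex^'m^'m) \<Rightarrow> real^'n^'n \<Rightarrow> ereal" where
  "dual_fun A B W \<Lambda> =
     ext_integral circle_measure (\<lambda>z. trace \<Lambda> - ln (Re (det (dual_matrix A B W \<Lambda> z))))"

end

theory Submission
  imports Defs "HOL-Complex_Analysis.Cauchy_Integral_Formula"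
begin

text \<open>
  Write \<open>Q = I + G\<^sub>1\<^sup>* \<Lambda> G\<^sub>1\<close>.  The functional is convex, and the theorem is an instance
  of the direct method: a minimizing sequence is bounded, and the functional is lower
  semicontinuous.  Strict convexity gives uniqueness.

  \<^emph>\<open>Coercivity.\<close>  The linear term \<open>tr \<Lambda>\<close> has no sign by itself.  Feasibility turns it into
  an integral against a positive density.  Let \<open>P\<close> be the orthogonal projection onto the range of
  \<open>B\<close> and \<open>Z = (I - P) A\<close>.  Compressing \<open>I - A A\<^sup>T = B H + H\<^sup>T B\<^sup>T\<close> by \<open>I - P\<close> gives
  \<open>Z Z\<^sup>T = I - P\<close>, that is, \<open>I\<close> solves the Lyapunov equation \<open>X - Z X Z\<^sup>T = P\<close>; stability of \<open>A\<close>
  makes \<open>Z\<close> stable.  Hence \<open>\<integral> (zI - Z)\<^sup>-\<^sup>1 P (zI - Z)\<^sup>-\<^sup>* = I\<close>, and the integrand is \<open>G V V\<^sup>* G\<^sup>*\<close> for a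
  continuous \<open>V\<close> with a continuous right inverse (\<open>maximum_entropy_factor\<close>; \<open>V V\<^sup>*\<close> is the
  maximum entropy density with covariance \<open>I\<close>).  With \<open>U = W\<^sup>-\<^sup>1\<close> this yields
  \<open>\<integral> tr ((U V)\<^sup>* Q (U V)) = tr \<Lambda> + \<integral> tr ((U V)\<^sup>* (U V))\<close> (\<open>energy_integral\<close>).
  For positive definite \<open>Q\<close> the left integrand dominates a multiple of the norm of \<open>Q\<close>
  (\<open>Q_le_energy\<close>), while \<open>log det Q\<close> grows only logarithmically in that norm
  (\<open>ln_det_le_norm\<close>).  So the functional is bounded below by a multiple of \<open>\<integral> \<parallel>G\<^sup>* \<Lambda> G\<parallel>\<close> minus a
  constant, and on the range of \<open>\<Gamma>\<close>, which is orthogonal to all \<open>\<Lambda>\<close> with \<open>G\<^sup>* \<Lambda> G = 0\<close>, this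
  integral is equivalent to the norm of \<open>\<Lambda>\<close> (\<open>range_Gamma_norm_le\<close>, \<open>dual_fun_coercive\<close>).

  \<^emph>\<open>Existence.\<close>  On bounded sets of \<open>\<Lambda>\<close> the integrands are bounded below by one constant, so
  Fatou's lemma applies along a convergent minimizing sequence.  The limiting \<open>Q\<close> is positive
  semidefinite almost everywhere, and where it is singular the integrands tend to infinity;
  as the values of the functional stay bounded, this happens only on a null set, and the limit
  is feasible (\<open>dual_fun_lower_semicontinuous\<close>).

  \<^emph>\<open>Uniqueness.\<close>  Two positive definite matrices can be diagonalized by one congruence, which
  reduces strict concavity of \<open>log det\<close> to that of the logarithm (\<open>ln_det_midpoint\<close>).  If two
  minimizers existed, their midpoint would force equality almost everywhere, hence
  \<open>G\<^sup>* (\<Lambda> - \<Lambda>') G = 0\<close> almost everywhere, and \<open>\<Lambda> = \<Lambda>'\<close> on the range of \<open>\<Gamma>\<close>.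
\<close>

section \<open>Complex matrices\<close>

lemma matrix_add_rdistrib: "((B::'a::semiring_1^'n^'m) + C) ** A = B ** A + C ** A"
  by (vector matrix_matrix_mult_def sum.distrib distrib_right)

lemma matrix_diff_ldistrib: "(A::'a::ring_1^'n^'m) ** (B - C) = A ** B - A ** C"
  by (vector matrix_matrix_mult_def sum_subtractf right_diff_distrib)

lemma matrix_diff_rdistrib: "((B::'a::ring_1^'n^'m) - C) ** A = B ** A - C ** A"
  by (vector matrix_matrix_mult_def sum_subtractf left_diff_distrib)

lemma ctranspose_nth [simp]: "ctranspose M $ i $ j = cnj (M $ j $ i)"
  by (simp add: ctranspose_def transpose_def)

lemma ctranspose_mult: "ctranspose (X ** Y) = ctranspose Y ** ctranspose X"
  by (simp add: vec_eq_iff matrix_matrix_mult_def mult.commute)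

lemma ctranspose_ctranspose [simp]: "ctranspose (ctranspose X) = X"
  by (simp add: vec_eq_iff)

lemma ctranspose_add: "ctranspose (X + Y) = ctranspose X + ctranspose Y"
  by (simp add: vec_eq_iff)

lemma ctranspose_diff: "ctranspose (X - Y) = ctranspose X - ctranspose Y"
  by (simp add: vec_eq_iff)

lemma ctranspose_scaleR: "ctranspose (c *\<^sub>R X) = c *\<^sub>R ctranspose X"
  by (simp add: vec_eq_iff)

lemma ctranspose_mat: "ctranspose (mat c) = mat (cnj c)"
  by (simp add: vec_eq_iff mat_def)

lemma ctranspose_cmat: "ctranspose (cmat X) = cmat (transpose X)"
  by (simp add: vec_eq_iff transpose_def)

lemma cmat_mult: "cmat (X ** Y) = cmat X ** cmat Y"
  by (simp add: vec_eq_iff matrix_matrix_mult_def)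

lemma cmat_diff: "cmat (X - Y) = cmat X - cmat Y"
  by (simp add: vec_eq_iff)

lemma cmat_mat: "cmat (mat c) = mat (complex_of_real c)"
  by (simp add: vec_eq_iff mat_def)

lemma cmat_inner: "cmat X \<bullet> cmat Y = X \<bullet> Y"
  by (simp add: inner_vec_def inner_complex_def)

lemma linear_cmat: "linear (cmat :: real^'n^'m \<Rightarrow> _)"
  by (rule linearI) (simp_all add: vec_eq_iff scaleR_conv_of_real[where 'a=complex])

lemma inner_ctranspose: "ctranspose X \<bullet> ctranspose Y = X \<bullet> Y"
  unfolding inner_vec_def by (subst sum.swap) (simp add: inner_complex_def)

lemma norm_ctranspose: "norm (ctranspose X) = norm X"
  by (simp add: norm_eq_sqrt_inner inner_ctranspose)

lemma bounded_linear_ctranspose: "bounded_linear (ctranspose :: complex^'n^'m \<Rightarrow> _)"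
  by (intro linear_conv_bounded_linear[THEN iffD1] linearI ctranspose_add ctranspose_scaleR)

lemma det_ctranspose: "det (ctranspose X) = cnj (det X)"
proof -
  have "det (map_matrix cnj Y) = cnj (det Y)" for Y :: "complex^'n^'n"
    by (simp add: det_def)
  from this[of "transpose X"] show ?thesis by (simp add: ctranspose_def)
qed

lemma inner_matrix_mult_left:
  fixes P :: "complex^'n^'m" and Y :: "complex^'k^'n"
  shows "X \<bullet> (P ** Y) = (ctranspose P ** X) \<bullet> Y"
proof -
  have "X \<bullet> (P ** Y) = (\<Sum>i\<in>UNIV. \<Sum>j\<in>UNIV. \<Sum>k\<in>UNIV. Re (cnj (X$i$j) * P$i$k * Y$k$j))"
    by (simp add: inner_vec_def matrix_matrix_mult_def inner_complex_def sum_distrib_left algebra_simps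
        sum_subtractf sum.distrib)
  also have "\<dots> = (\<Sum>k\<in>UNIV. \<Sum>j\<in>UNIV. \<Sum>i\<in>UNIV. Re (cnj (X$i$j) * P$i$k * Y$k$j))"
    by (subst sum.swap, subst (2) sum.swap, subst sum.swap, rule refl)
  also have "\<dots> = (ctranspose P ** X) \<bullet> Y"
    by (simp add: inner_vec_def matrix_matrix_mult_def inner_complex_def sum_distrib_right sum_distrib_left algebra_simps
        sum_subtractf sum.distrib)
  finally show ?thesis .
qed

lemma inner_matrix_mult_right:
  fixes P :: "complex^'k^'n" and Y :: "complex^'n^'m"
  shows "X \<bullet> (Y ** P) = (X ** ctranspose P) \<bullet> Y"
proof -
  have "X \<bullet> (Y ** P) = ctranspose X \<bullet> (ctranspose P ** ctranspose Y)"
    by (metis inner_ctranspose ctranspose_mult)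
  also have "\<dots> = ctranspose (X ** ctranspose P) \<bullet> ctranspose Y"
    by (simp add: inner_matrix_mult_left ctranspose_mult)
  finally show ?thesis by (simp only: inner_ctranspose)
qed

lemma bounded_bilinear_matrix_mult:
  "bounded_bilinear ((**) :: complex^'n^'m \<Rightarrow> complex^'k^'n \<Rightarrow> complex^'k^'m)"
  unfolding bilinear_conv_bounded_bilinear[symmetric] bilinear_def
  by (intro conjI allI linearI;
      vector matrix_matrix_mult_def sum.distrib algebra_simps scaleR_sum_right)

section \<open>Simultaneous diagonalization\<close>

definition cdot :: "complex^'n \<Rightarrow> complex^'n \<Rightarrow> complex" where
  "cdot u v = (\<Sum>i\<in>UNIV. cnj (u$i) * v$i)"

lemma Re_cdot: "Re (cdot u v) = u \<bullet> v"
  by (simp add: cdot_def inner_vec_def inner_complex_def)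

lemma cdot_adjoint: "cdot u (M *v v) = cdot (ctranspose M *v u) v"
proof -
  have "cdot u (M *v v) = (\<Sum>i\<in>UNIV. \<Sum>j\<in>UNIV. cnj (u$i) * M$i$j * v$j)"
    by (simp add: cdot_def matrix_vector_mult_def sum_distrib_left mult.assoc)
  also have "\<dots> = cdot (ctranspose M *v u) v"
    by (subst sum.swap) (simp add: cdot_def matrix_vector_mult_def sum_distrib_left sum_distrib_right algebra_simps)
  finally show ?thesis .
qed

lemma cdot_commute: "cdot u v = cnj (cdot v u)"
  by (simp add: cdot_def mult.commute)

lemma cdot_linear_right:
  "cdot u (v + w) = cdot u v + cdot u w" "cdot u (v - w) = cdot u v - cdot u w"
  "cdot u (c *s v) = c * cdot u v" "cdot u 0 = 0"
  by (simp_all add: cdot_def algebra_simps sum.distrib sum_subtractf sum_distrib_left)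

lemma cdot_sum_right: "cdot u (sum f S) = (\<Sum>i\<in>S. cdot u (f i))"
  by (induction S rule: infinite_finite_induct) (simp_all add: cdot_linear_right)

lemma cdot_linear_left:
  "cdot (v + w) u = cdot v u + cdot w u" "cdot (c *s v) u = cnj c * cdot v u"
  by (simp_all add: cdot_def algebra_simps sum.distrib sum_distrib_left)

lemma cdot_eq_0: "(\<And>u. cdot u v = 0) \<Longrightarrow> v = 0"
  by (metis Re_cdot inner_eq_zero_iff zero_complex.sel(1))

lemma scaleR_vec_eq: "t *\<^sub>R v = complex_of_real t *s (v::complex^'n)"
  by (simp add: vec_eq_iff scaleR_conv_of_real[where 'a=complex])

lemma scaleR_matrix_vector: "(c *\<^sub>R M) *v v = c *\<^sub>R (M *v (v::complex^'n))"
  by (simp add: vec_eq_iff matrix_vector_mult_def scaleR_sum_right)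

lemma matrix_vector_scaleR: "M *v (c *\<^sub>R v) = c *\<^sub>R (M *v (v::complex^'n))"
  by (simp add: vec_eq_iff matrix_vector_mult_def scaleR_sum_right)

lemma matrix_vector_sum: "M *v (sum f S) = (\<Sum>i\<in>S. M *v (f i :: complex^'n))"
  by (induction S rule: infinite_finite_induct) (simp_all add: matrix_vector_right_distrib)

lemma hermitian_inner: "hermitian M \<Longrightarrow> u \<bullet> (M *v v) = v \<bullet> (M *v u)"
  by (metis Re_cdot cdot_adjoint cdot_commute hermitian_def inner_commute)

text \<open>A nonnegative quadratic form attains its minimum 0 at a null vector, so its first variation
  vanishes there in every direction \<open>u\<close>; the direction \<open>\<i> u\<close> takes care of the imaginary part.
  Only nonnegativity on \<open>U\<close> is available where this is applied.\<close>
lemma psd_null_form: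
  assumes "hermitian M" and add: "\<And>u v. u \<in> U \<Longrightarrow> v \<in> U \<Longrightarrow> u + v \<in> U"
    and scale: "\<And>c u. u \<in> U \<Longrightarrow> c *s u \<in> U"
    and nonneg: "\<And>u. u \<in> U \<Longrightarrow> 0 \<le> u \<bullet> (M *v u)"
    and "v \<in> U" "v \<bullet> (M *v v) = 0" "u \<in> U"
  shows "cdot u (M *v v) = 0"
proof -
  have *: "u \<bullet> (M *v v) = 0" if "u \<in> U" for u
  proof (rule ccontr)
    assume ne: "u \<bullet> (M *v v) \<noteq> 0"
    define a where "a = u \<bullet> (M *v u)"
    define b where "b = u \<bullet> (M *v v)"
    have "a \<ge> 0" using nonneg[OF that] by (simp add: a_def)
    have q: "0 \<le> 2 * t * b + t\<^sup>2 * a" for t :: real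
    proof -
      have "v + t *\<^sub>R u \<in> U" using that assms(5) add scale scaleR_vec_eq by metis
      from nonneg[OF this] have "0 \<le> (v + t *\<^sub>R u) \<bullet> (M *v (v + t *\<^sub>R u))" .
      moreover have "M *v (v + t *\<^sub>R u) = M *v v + t *\<^sub>R (M *v u)"
        by (simp add: matrix_vector_right_distrib matrix_vector_scaleR)
      ultimately show ?thesis
        using assms(6) hermitian_inner[OF assms(1), of v u]
        by (simp add: inner_add_left inner_add_right a_def b_def power2_eq_square algebra_simps)
    qed
    \<comment> \<open>The form at \<open>v - c u\<close> is \<open>c (c a - 2 b)\<close>; dividing by \<open>a + 1\<close> rather than \<open>a\<close> avoids the case \<open>a = 0\<close>.\<close>
    define c where "c = b / (a + 1)"
    have b: "b = c * (a + 1)" and "c \<noteq> 0" using ne \<open>a \<ge> 0\<close> by (simp_all add: c_def b_def)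
    then have "c\<^sup>2 * (a + 2) > 0" using \<open>a \<ge> 0\<close> by simp
    moreover have "2 * (- c) * b + (- c)\<^sup>2 * a = - (c\<^sup>2 * (a + 2))"
      by (simp add: b power2_eq_square algebra_simps)
    ultimately show False using q[of "- c"] by simp
  qed
  have "Re (cdot u (M *v v)) = 0" using *[OF assms(7)] by (simp add: Re_cdot)
  moreover have "Re (cdot (\<i> *s u) (M *v v)) = 0" using *[OF scale[OF assms(7)]] by (simp add: Re_cdot)
  ultimately show ?thesis by (simp add: cdot_linear_left complex_eq_iff)
qed

text \<open>The pencil \<open>Y - \<lambda> X\<close> is diagonalized one vector at a time.  On the \<open>X\<close>-orthogonal complement
  \<open>U\<close> of the vectors found so far the Rayleigh quotient of \<open>Y\<close> relative to \<open>X\<close> attains its maximum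
  \<open>l\<close>, and there \<open>l X - Y\<close> is a nonnegative form on \<open>U\<close> with a null vector \<open>v\<close>.  So \<open>(l X - Y) v\<close>
  is orthogonal to \<open>U\<close>, and it is orthogonal to the earlier vectors because they are
  eigenvectors; hence it is 0.  The induction runs over sets of indices since the dimension is
  a type.\<close>
lemma simultaneous_eigenvectors:
  fixes X Y :: "complex^'n^'n"
  assumes X: "posdef X" and Y: "hermitian Y" and "finite S"
  shows "\<exists>b (d :: 'n \<Rightarrow> real). (\<forall>i\<in>S. Y *v b i = complex_of_real (d i) *s (X *v b i)) \<and>
           (\<forall>i\<in>S. \<forall>j\<in>S. cdot (b i) (X *v b j) = (if i = j then 1 else 0))"
  using \<open>finite S\<close>
proof (induction S rule: finite_induct)
  case empty
  then show ?case by simp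
next
  case (insert k S)
  then obtain b d where
    eig: "\<And>i. i \<in> S \<Longrightarrow> Y *v b i = complex_of_real (d i) *s (X *v b i)" and
    orth: "\<And>i j. i \<in> S \<Longrightarrow> j \<in> S \<Longrightarrow> cdot (b i) (X *v b j) = (if i = j then 1 else 0)"
    by blast
  have hX: "hermitian X" using X by (simp add: posdef_def)
  have posX: "0 < v \<bullet> (X *v v)" if "v \<noteq> 0" for v using X that by (simp add: posdef_def)
  define U where "U = {v. \<forall>i\<in>S. cdot (b i) (X *v v) = 0}"
  have Uadd: "u + v \<in> U" if "u \<in> U" "v \<in> U" for u v
    using that by (simp add: U_def matrix_vector_right_distrib cdot_linear_right)
  have Uscale: "c *s u \<in> U" if "u \<in> U" for c u
    using that by (simp add: U_def cdot_linear_right vector_scalar_commute)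
  \<comment> \<open>A square matrix with kernel \<open>U\<close>; its row \<open>k\<close> is zero, so \<open>U\<close> contains a nonzero vector.\<close>
  define N :: "complex^'n^'n" where
    "N = (\<chi> i j. if i \<in> S then cnj ((X *v b i) $ j) else 0)"
  have N: "(N *v v) $ i = (if i \<in> S then cdot (b i) (X *v v) else 0)" for v i
  proof -
    have "cdot (b i) (X *v v) = cdot (X *v b i) v"
      using hX by (metis cdot_adjoint hermitian_def)
    then show ?thesis by (simp add: N_def matrix_vector_mult_def cdot_def)
  qed
  have UN: "v \<in> U \<longleftrightarrow> N *v v = 0" for v
    unfolding vec_eq_iff N U_def by auto
  have "N $ k = 0" using insert.hyps by (simp add: N_def vec_eq_iff)
  then have "det N = 0" by (intro det_zero_row(1)) (auto simp: row_def vec_eq_iff)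
  then have "\<not> invertible N" by (simp add: invertible_det_nz)
  then obtain v0 where v0: "v0 \<noteq> 0" "N *v v0 = 0"
    by (metis invertible_left_inverse matrix_left_invertible_ker)
  define K where "K = {v. N *v v = 0 \<and> norm v = 1}"
  have contM: "continuous_on UNIV (\<lambda>v. M *v v)" for M :: "complex^'n^'n"
    unfolding matrix_vector_mult_def by (intro continuous_intros)
  have "K = {v. N *v v = 0} \<inter> sphere 0 1" by (auto simp: K_def)
  moreover have "closed {v. N *v v = 0}"
    by (intro closed_Collect_eq contM continuous_intros)
  ultimately have "compact K" by (simp add: closed_Int_compact)
  define w0 where "w0 = (1 / norm v0) *\<^sub>R v0"
  have "w0 \<in> U" using v0 Uscale scaleR_vec_eq unfolding w0_def UN[symmetric] by metis
  then have "w0 \<in> K" using v0 by (simp add: K_def UN w0_def)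
  then have "K \<noteq> {}" by blast
  define q where "q v = (v \<bullet> (Y *v v)) / (v \<bullet> (X *v v))" for v
  have "continuous_on K q"
    unfolding q_def
    by (intro continuous_intros continuous_on_subset[OF contM])
       (auto simp: K_def dest!: posX[OF zero_less_norm_iff[THEN iffD1]] intro: less_imp_neq, metis norm_zero posX less_irrefl zero_neq_one)
  from continuous_attains_sup[OF \<open>compact K\<close> \<open>K \<noteq> {}\<close> this]
  obtain v where v: "v \<in> K" and max: "\<And>u. u \<in> K \<Longrightarrow> q u \<le> q v" by blast
  define l where "l = q v"
  have "v \<noteq> 0" using v by (auto simp: K_def)
  have "v \<in> U" using v by (simp add: K_def UN)
  define Z where "Z = l *\<^sub>R X - Y"
  have Zv: "Z *v u = l *\<^sub>R (X *v u) - Y *v u" for u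
    by (simp add: Z_def matrix_vector_mult_diff_rdistrib scaleR_matrix_vector)
  have hZ: "hermitian Z"
    using hX Y by (simp add: hermitian_def Z_def ctranspose_diff ctranspose_scaleR)
  have nonneg: "0 \<le> u \<bullet> (Z *v u)" if "u \<in> U" for u
  proof (cases "u = 0")
    case False
    define w where "w = (1 / norm u) *\<^sub>R u"
    have "w \<in> U" using that Uscale scaleR_vec_eq unfolding w_def by metis
    then have "w \<in> K" using False by (simp add: K_def UN w_def)
    have "q w = q u" using False by (simp add: q_def w_def matrix_vector_scaleR)
    then have "q u \<le> l" using max[OF \<open>w \<in> K\<close>] by (simp add: l_def)
    then have "u \<bullet> (Y *v u) \<le> l * (u \<bullet> (X *v u))"
      using posX[OF False] by (simp add: q_def pos_divide_le_eq)
    then show ?thesis by (simp add: Zv inner_diff_right)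
  qed simp
  have null: "v \<bullet> (Z *v v) = 0"
    using posX[OF \<open>v \<noteq> 0\<close>] by (simp add: Zv inner_diff_right l_def q_def)
  have ZU: "cdot u (Z *v v) = 0" if "u \<in> U" for u
    by (rule psd_null_form[OF hZ Uadd Uscale nonneg \<open>v \<in> U\<close> null that])
  have Zb: "cdot (b i) (Z *v v) = 0" if "i \<in> S" for i
  proof -
    have "cdot (b i) (Y *v v) = cdot (Y *v b i) v" using Y by (metis cdot_adjoint hermitian_def)
    also have "\<dots> = complex_of_real (d i) * cdot (X *v b i) v" by (simp add: eig[OF that] cdot_linear_left)
    also have "cdot (X *v b i) v = cdot (b i) (X *v v)" using hX by (metis cdot_adjoint hermitian_def)
    also have "\<dots> = 0" using \<open>v \<in> U\<close> that by (simp add: U_def)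
    finally show ?thesis using \<open>v \<in> U\<close> that
      by (simp add: Zv scaleR_vec_eq cdot_linear_right U_def)
  qed
  have "cdot w (Z *v v) = 0" for w
  proof -
    \<comment> \<open>The \<open>X\<close>-orthogonal projection of \<open>w\<close> onto the span of the earlier vectors.\<close>
    define p where "p = (\<Sum>i\<in>S. cdot (b i) (X *v w) *s b i)"
    have "cdot (b j) (X *v p) = cdot (b j) (X *v w)" if "j \<in> S" for j
    proof -
      have "X *v p = (\<Sum>i\<in>S. cdot (b i) (X *v w) *s (X *v b i))"
        unfolding p_def by (simp add: matrix_vector_sum vector_scalar_commute)
      then have "cdot (b j) (X *v p) = (\<Sum>i\<in>S. cdot (b i) (X *v w) * (if j = i then 1 else 0))"
        using orth that by (simp add: cdot_sum_right cdot_linear_right)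
      then show ?thesis using that \<open>finite S\<close> by (simp add: if_distrib cong: if_cong)
    qed
    then have "w - p \<in> U" by (simp add: U_def matrix_vector_mult_diff_distrib cdot_linear_right)
    moreover have "cdot p (Z *v v) = 0"
      unfolding p_def by (subst cdot_commute) (simp add: cdot_sum_right cdot_linear_right cdot_commute[of "Z *v v"] Zb)
    ultimately show ?thesis using ZU[of "w - p"] cdot_linear_left(1)[of "w - p" p] by simp
  qed
  then have "Z *v v = 0" by (rule cdot_eq_0)
  then have eigv: "Y *v v = complex_of_real l *s (X *v v)"
    by (simp add: Zv scaleR_vec_eq)
  define r where "r = 1 / sqrt (v \<bullet> (X *v v))"
  define c where "c = complex_of_real r *s v"
  have "cnj (cdot v (X *v v)) = cdot v (X *v v)"
    using hX by (metis cdot_adjoint cdot_commute hermitian_def)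
  then have "cdot v (X *v v) = complex_of_real (v \<bullet> (X *v v))"
    by (simp add: Re_cdot[symmetric] complex_eq_iff)
  moreover have "r * r * (v \<bullet> (X *v v)) = 1"
    using posX[OF \<open>v \<noteq> 0\<close>] by (simp add: r_def)
  ultimately have cc: "cdot c (X *v c) = 1"
    by (simp add: c_def vector_scalar_commute cdot_linear_right cdot_linear_left)
       (metis of_real_1 of_real_mult mult.assoc)
  have "c \<in> U" using \<open>v \<in> U\<close> Uscale by (simp add: c_def)
  then have bc: "cdot (b i) (X *v c) = 0" if "i \<in> S" for i using that by (simp add: U_def)
  have cb: "cdot c (X *v b i) = 0" if "i \<in> S" for i
    using bc[OF that] hX by (metis cdot_adjoint cdot_commute complex_cnj_zero hermitian_def)
  have eigc: "Y *v c = complex_of_real l *s (X *v c)"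
    by (simp add: c_def vector_scalar_commute eigv mult.commute)
  show ?case
    apply (rule exI[of _ "b(k := c)"], rule exI[of _ "d(k := l)"])
    using insert.hyps eig orth cc bc cb eigc by auto
qed

lemma simultaneous_diagonalization:
  fixes X Y :: "complex^'n^'n"
  assumes "posdef X" and "hermitian Y"
  obtains S and d :: "'n \<Rightarrow> real" where
    "ctranspose S ** X ** S = mat 1"
    "ctranspose S ** Y ** S = (\<chi> i j. if i = j then complex_of_real (d i) else 0)"
proof -
  obtain b and d :: "'n \<Rightarrow> real" where
    eig: "\<And>i. Y *v b i = complex_of_real (d i) *s (X *v b i)" and
    orth: "\<And>i j. cdot (b i) (X *v b j) = (if i = j then 1 else 0)"
    using simultaneous_eigenvectors[OF assms finite_class.finite_UNIV] by auto
  define S where "S = (\<chi> i j. b j $ i)"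
  have entry: "(ctranspose S ** M ** S) $ i $ j = cdot (b i) (M *v b j)" for M i j
    unfolding matrix_mul_assoc[symmetric]
    by (simp add: matrix_matrix_mult_def cdot_def S_def matrix_vector_mult_def)
  show ?thesis
    by (rule that[of S d]) (simp_all add: vec_eq_iff entry orth eig cdot_linear_right mat_def)
qed

section \<open>Determinants of positive definite matrices\<close>

text \<open>A congruence \<open>S\<close> with \<open>S\<^sup>* Q S = I\<close> is invertible, and \<open>F = S\<^sup>* Q\<close> is its inverse.\<close>
lemma posdef_factorization:
  fixes Q :: "complex^'n^'n"
  assumes "posdef Q"
  obtains F :: "complex^'n^'n" where "Q = ctranspose F ** F"
proof -
  have "hermitian Q" using assms by (simp add: posdef_def)
  from simultaneous_diagonalization[OF assms this]
  obtain S and d :: "'n \<Rightarrow> real" where S: "ctranspose S ** Q ** S = mat 1"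
    and "ctranspose S ** Q ** S = (\<chi> i j. if i = j then complex_of_real (d i) else 0)" .
  then have "ctranspose S ** (Q ** S) = mat 1" by (simp add: matrix_mul_assoc)
  then have "(Q ** S) ** ctranspose S = mat 1" by (rule matrix_left_right_inverse[THEN iffD1])
  then have "Q ** (S ** ctranspose S) = mat 1" by (simp add: matrix_mul_assoc)
  then have "(S ** ctranspose S) ** Q = mat 1" by (rule matrix_left_right_inverse[THEN iffD1])
  then have "S ** (ctranspose S ** Q) = mat 1" by (simp add: matrix_mul_assoc)
  then have F: "ctranspose S ** Q ** S = mat 1 \<and> S ** (ctranspose S ** Q) = mat 1" using S by simp
  define F where "F = ctranspose S ** Q"
  have FS: "S ** F = mat 1" using F by (simp add: F_def)
  have "ctranspose F ** ctranspose S = mat 1"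
    unfolding ctranspose_mult[symmetric] FS by (simp add: ctranspose_mat)
  moreover have "ctranspose F ** F = ctranspose F ** ctranspose S ** Q"
    by (simp add: F_def matrix_mul_assoc)
  ultimately show ?thesis using that[of F] by simp
qed

lemma posdef_ker: "posdef M \<Longrightarrow> M *v v = 0 \<Longrightarrow> v = 0"
  unfolding posdef_def by (rule ccontr) (auto dest: spec[of _ v])

lemma det_nz_iff_ker:
  "det (M :: 'a::field^'n^'n) \<noteq> 0 \<longleftrightarrow> (\<forall>v. M *v v = 0 \<longrightarrow> v = 0)"
  unfolding invertible_det_nz[symmetric] invertible_left_inverse matrix_left_invertible_ker ..

lemma det_posdef:
  fixes M :: "complex^'n^'n"
  assumes "posdef M"
  shows "0 < Re (det M)" "det M = complex_of_real (Re (det M))"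
proof -
  have nz: "det M \<noteq> 0" using posdef_ker[OF assms] by (auto simp: det_nz_iff_ker)
  obtain F :: "complex^'n^'n" where "M = ctranspose F ** F" by (rule posdef_factorization[OF assms])
  then have eq: "det M = complex_of_real ((cmod (det F))\<^sup>2)"
    unfolding complex_norm_square by (simp add: det_mul det_ctranspose mult.commute)
  show "det M = complex_of_real (Re (det M))" unfolding eq by simp
  show "0 < Re (det M)" using nz unfolding eq by simp
qed

lemma posdef_imp_psd:
  assumes "posdef M"
  shows "psd M"
  unfolding psd_def
proof (intro conjI allI)
  show "hermitian M" using assms by (simp add: posdef_def)
  show "0 \<le> v \<bullet> (M *v v)" for v
    using assms by (cases "v = 0") (simp_all add: posdef_def less_imp_le)
qed

text \<open>At a null vector \<open>v\<close> of a positive semidefinite form, \<open>M v = 0\<close>.\<close>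
lemma psd_imp_posdef:
  assumes "psd M" "det M \<noteq> 0"
  shows "posdef M"
  unfolding posdef_def
proof (intro conjI allI impI)
  show h: "hermitian M" using assms by (simp add: psd_def)
  fix v :: "complex^'a" assume "v \<noteq> 0"
  have "v \<bullet> (M *v v) \<noteq> 0"
  proof
    assume "v \<bullet> (M *v v) = 0"
    then have "cdot u (M *v v) = 0" for u
      using psd_null_form[OF h, of UNIV v u] assms(1) by (simp add: psd_def)
    then have "M *v v = 0" by (rule cdot_eq_0)
    then show False using assms(2) \<open>v \<noteq> 0\<close> by (simp add: det_nz_iff_ker)
  qed
  then show "0 < v \<bullet> (M *v v)" using assms(1) by (simp add: psd_def less_le)
qed

lemma posdef_mat_1: "posdef (mat 1)"
  by (simp add: posdef_def hermitian_def ctranspose_mat)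

lemma posdef_midpoint:
  assumes "posdef X" "posdef Y"
  shows "posdef ((1/2) *\<^sub>R (X + Y))"
  using assms
  by (auto simp: posdef_def hermitian_def ctranspose_scaleR ctranspose_add scaleR_matrix_vector
      matrix_vector_mult_add_rdistrib inner_add_right intro!: add_pos_pos)

lemma ln_midpoint_one:
  assumes "d > (0::real)"
  shows "ln d \<le> 2 * ln ((1 + d) / 2)" "ln d = 2 * ln ((1 + d) / 2) \<Longrightarrow> d = 1"
proof -
  have sq: "((1 + d) / 2)\<^sup>2 - d = ((1 - d) / 2)\<^sup>2" by (simp add: power2_eq_square field_simps)
  have ln2: "2 * ln ((1 + d) / 2) = ln (((1 + d) / 2)\<^sup>2)" using assms by (simp add: ln_realpow)
  have "d \<le> ((1 + d) / 2)\<^sup>2" using sq by (smt (verit) zero_le_power2)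
  then show "ln d \<le> 2 * ln ((1 + d) / 2)" unfolding ln2 using assms by (subst ln_le_cancel_iff) auto
  assume "ln d = 2 * ln ((1 + d) / 2)"
  then have "d = ((1 + d) / 2)\<^sup>2" unfolding ln2 using assms by (subst (asm) ln_inj_iff) auto
  then show "d = 1" using sq by simp
qed

text \<open>Strict midpoint concavity of \<open>log det\<close>.  A congruence \<open>S\<close> with \<open>S\<^sup>* X S = I\<close> and
  \<open>S\<^sup>* Y S = diag d\<close> multiplies all three determinants by the same factor \<open>s\<close>, so the gap is the
  sum over \<open>i\<close> of \<open>2 log ((1 + d i)/2) - log (d i)\<close>.\<close>
lemma ln_det_midpoint:
  fixes X Y :: "complex^'n^'n"
  assumes X: "posdef X" and Y: "posdef Y"
  defines "D \<equiv> (1/2) *\<^sub>R (X + Y)"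
  shows "ln (Re (det X)) + ln (Re (det Y)) \<le> 2 * ln (Re (det D))"
    and "ln (Re (det X)) + ln (Re (det Y)) = 2 * ln (Re (det D)) \<Longrightarrow> X = Y"
proof -
  have "hermitian Y" using Y by (simp add: posdef_def)
  from simultaneous_diagonalization[OF X this]
  obtain S and d :: "'n \<Rightarrow> real" where
    SX: "ctranspose S ** X ** S = mat 1" and
    SY: "ctranspose S ** Y ** S = (\<chi> i j. if i = j then complex_of_real (d i) else 0)" .
  have SD: "ctranspose S ** D ** S = (\<chi> i j. if i = j then complex_of_real ((1 + d i) / 2) else 0)"
  proof -
    have "ctranspose S ** D ** S = (1/2) *\<^sub>R (ctranspose S ** X ** S + ctranspose S ** Y ** S)"
      by (simp add: D_def bounded_bilinear.scaleR_left[OF bounded_bilinear_matrix_mult]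
          bounded_bilinear.scaleR_right[OF bounded_bilinear_matrix_mult]
          bounded_bilinear.add_left[OF bounded_bilinear_matrix_mult]
          bounded_bilinear.add_right[OF bounded_bilinear_matrix_mult])
    also have "\<dots> = (\<chi> i j. if i = j then complex_of_real ((1 + d i) / 2) else 0)"
      unfolding SX SY by (simp add: vec_eq_iff mat_def scaleR_conv_of_real[where 'a=complex])
    finally show ?thesis .
  qed
  define s where "s = (cmod (det S))\<^sup>2"
  have det: "det (ctranspose S ** M ** S) = complex_of_real s * det M" for M
    unfolding det_mul det_ctranspose s_def complex_norm_square by (simp add: mult_ac)
  have diag: "det ((\<chi> i j. if i = j then complex_of_real (e i) else 0) :: complex^'n^'n)
      = complex_of_real (\<Prod>i\<in>UNIV. e i)" for e
    by (subst det_diagonal) auto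
  have dX: "s * Re (det X) = 1" using arg_cong[OF det[of X], of Re] by (simp add: SX)
  have dY: "s * Re (det Y) = (\<Prod>i\<in>UNIV. d i)"
    using arg_cong[OF det[of Y], of Re] unfolding SY diag by (simp del: of_real_prod)
  have dD: "s * Re (det D) = (\<Prod>i\<in>UNIV. (1 + d i) / 2)"
    using arg_cong[OF det[of D], of Re] unfolding SD diag by (simp del: of_real_prod)
  have "s > 0" using dX by (auto simp: s_def zero_less_mult_iff)
  have pos: "d i > 0" for i
  proof -
    have entry: "Re ((ctranspose S ** M ** S) $ i $ i) = column i S \<bullet> (M *v column i S)" for M
      unfolding matrix_mul_assoc[symmetric] Re_cdot[symmetric]
      by (simp add: matrix_matrix_mult_def cdot_def column_def matrix_vector_mult_def)
    have "column i S \<bullet> (X *v column i S) = 1" using entry[of X] by (simp add: SX mat_def)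
    then have "column i S \<noteq> 0" by auto
    then have "0 < column i S \<bullet> (Y *v column i S)" using Y by (simp add: posdef_def)
    then show ?thesis using entry[of Y] by (simp add: SY)
  qed
  have lnX: "ln (Re (det X)) = - ln s"
    using dX \<open>s > 0\<close> by (metis ln_inverse inverse_unique)
  have lnY: "ln (Re (det Y)) = (\<Sum>i\<in>UNIV. ln (d i)) - ln s"
  proof -
    have "Re (det Y) = (\<Prod>i\<in>UNIV. d i) / s" using dY \<open>s > 0\<close> by (simp add: field_simps)
    then have "ln (Re (det Y)) = ln (\<Prod>i\<in>UNIV. d i) - ln s"
      using \<open>s > 0\<close> prod_pos[of UNIV d, OF pos] by (simp only: ln_divide_pos)
    moreover have "ln (\<Prod>i\<in>UNIV. d i) = (\<Sum>i\<in>UNIV. ln (d i))"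
      by (rule ln_prod[OF finite_class.finite_UNIV]) (metis pos less_irrefl)
    ultimately show ?thesis by simp
  qed
  have lnD: "ln (Re (det D)) = (\<Sum>i\<in>UNIV. ln ((1 + d i) / 2)) - ln s"
  proof -
    have p: "(1 + d i) / 2 > 0" for i using pos[of i] by simp
    have "Re (det D) = (\<Prod>i\<in>UNIV. (1 + d i) / 2) / s" using dD \<open>s > 0\<close> by (simp add: field_simps)
    then have "ln (Re (det D)) = ln (\<Prod>i\<in>UNIV. (1 + d i) / 2) - ln s"
      using \<open>s > 0\<close> prod_pos[of UNIV "\<lambda>i. (1 + d i) / 2", OF p] by (simp only: ln_divide_pos)
    moreover have "ln (\<Prod>i\<in>UNIV. (1 + d i) / 2) = (\<Sum>i\<in>UNIV. ln ((1 + d i) / 2))"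
      by (rule ln_prod[OF finite_class.finite_UNIV]) (metis p less_irrefl)
    ultimately show ?thesis by simp
  qed
  have gap: "2 * ln (Re (det D)) - (ln (Re (det X)) + ln (Re (det Y)))
      = (\<Sum>i\<in>UNIV. 2 * ln ((1 + d i) / 2) - ln (d i))"
    unfolding lnX lnY lnD by (simp add: sum_subtractf sum_distrib_left)
  have nonneg: "0 \<le> 2 * ln ((1 + d i) / 2) - ln (d i)" for i
    using ln_midpoint_one(1)[OF pos[of i]] by simp
  show "ln (Re (det X)) + ln (Re (det Y)) \<le> 2 * ln (Re (det D))"
    using gap sum_nonneg[of UNIV "\<lambda>i. 2 * ln ((1 + d i) / 2) - ln (d i)"] nonneg by fastforce
  assume "ln (Re (det X)) + ln (Re (det Y)) = 2 * ln (Re (det D))"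
  then have "(\<Sum>i\<in>UNIV. 2 * ln ((1 + d i) / 2) - ln (d i)) = 0" using gap by simp
  then have "2 * ln ((1 + d i) / 2) - ln (d i) = 0" for i
    using sum_nonneg_eq_0_iff[of UNIV "\<lambda>i. 2 * ln ((1 + d i) / 2) - ln (d i)"] nonneg by fastforce
  then have "d i = 1" for i using ln_midpoint_one(2)[OF pos[of i]] by (metis eq_iff_diff_eq_0)
  then have "ctranspose S ** X ** S = ctranspose S ** Y ** S"
    unfolding SX SY by (simp add: vec_eq_iff mat_def)
  moreover have "invertible S" "invertible (ctranspose S)"
    using \<open>s > 0\<close> by (auto simp: invertible_det_nz det_ctranspose s_def)
  ultimately show "X = Y"
    by (metis invertible_def matrix_mul_assoc matrix_mul_lid matrix_mul_rid)
qed

text \<open>If \<open>Q = F\<^sup>* F\<close> then \<open>V \<bullet> Q V\<close> is the squared norm of \<open>F V\<close>, and \<open>F = (F V) Y\<close>.  The constant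
  only comes from submultiplicativity of the norm up to a factor.\<close>
lemma norm_posdef_le:
  obtains K :: real where "K \<ge> 0"
    "\<And>(Q :: complex^'m^'m) (V :: complex^'n^'m) Y. posdef Q \<Longrightarrow> V ** Y = mat 1 \<Longrightarrow>
       norm Q \<le> K * (norm Y)\<^sup>2 * (V \<bullet> (Q ** V))"
proof -
  obtain K1 where K1: "K1 > 0"
    "\<And>(X :: complex^'m^'m) (Y :: complex^'m^'m). norm (X ** Y) \<le> norm X * norm Y * K1"
    using bounded_bilinear.pos_bounded[OF bounded_bilinear_matrix_mult] by blast
  obtain K2 where K2: "K2 > 0"
    "\<And>(X :: complex^'n^'m) (Y :: complex^'m^'n). norm (X ** Y) \<le> norm X * norm Y * K2"
    using bounded_bilinear.pos_bounded[OF bounded_bilinear_matrix_mult] by blast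
  have "norm Q \<le> (K1 * K2\<^sup>2) * (norm Y)\<^sup>2 * (V \<bullet> (Q ** V))"
    if "posdef Q" and VY: "V ** Y = mat 1" for Q :: "complex^'m^'m" and V :: "complex^'n^'m" and Y
  proof -
    obtain F :: "complex^'m^'m" where F: "Q = ctranspose F ** F" by (rule posdef_factorization[OF \<open>posdef Q\<close>])
    have form: "V \<bullet> (Q ** V) = (norm (F ** V))\<^sup>2"
      by (simp add: F matrix_mul_assoc[symmetric] inner_matrix_mult_left power2_norm_eq_inner)
    have "F = (F ** V) ** Y" by (simp add: matrix_mul_assoc[symmetric] VY)
    then have "norm F \<le> norm (F ** V) * norm Y * K2" using K2(2) by metis
    then have "(norm F)\<^sup>2 \<le> (norm (F ** V) * norm Y * K2)\<^sup>2" by (rule power_mono) simp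
    moreover have "norm Q \<le> (norm F)\<^sup>2 * K1"
      using K1(2)[of "ctranspose F" F] by (simp add: F norm_ctranspose power2_eq_square)
    ultimately have "norm Q \<le> (norm (F ** V) * norm Y * K2)\<^sup>2 * K1"
      using K1(1) by (meson less_imp_le mult_right_mono order_trans)
    then show ?thesis by (simp add: form power_mult_distrib mult_ac)
  qed
  moreover have "K1 * K2\<^sup>2 \<ge> 0" using K1 by simp
  ultimately show ?thesis using that by blast
qed

lemma norm_det_le: "cmod (det (M :: complex^'m^'m)) \<le> fact CARD('m) * norm M ^ CARD('m)"
proof -
  have "cmod (det M) \<le> (\<Sum>p | p permutes (UNIV :: 'm set). cmod (of_int (sign p) * (\<Prod>i\<in>UNIV. M $ i $ p i)))"
    unfolding det_def by (rule norm_sum)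
  also have "\<dots> \<le> (\<Sum>p | p permutes (UNIV :: 'm set). norm M ^ CARD('m))"
  proof (rule sum_mono)
    fix p :: "'m \<Rightarrow> 'm"
    have "cmod (of_int (sign p)) = 1" by (simp add: sign_def)
    moreover have "(\<Prod>i\<in>UNIV. cmod (M $ i $ p i)) \<le> (\<Prod>i\<in>(UNIV::'m set). norm M)"
      by (rule prod_mono) (meson Finite_Cartesian_Product.norm_nth_le norm_ge_zero order_trans)
    ultimately show "cmod (of_int (sign p) * (\<Prod>i\<in>UNIV. M $ i $ p i)) \<le> norm M ^ CARD('m)"
      unfolding norm_mult prod_norm[symmetric] by simp
  qed
  also have "\<dots> = fact CARD('m) * norm M ^ CARD('m)"
    by (simp add: card_permutations)
  finally show ?thesis .
qed

text \<open>The determinant is bounded by a constant times the \<open>m\<close>-th power of the norm, and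
  \<open>log t \<le> c t - log c - 1\<close> for every \<open>c > 0\<close>.\<close>
lemma ln_det_le_norm:
  assumes "\<epsilon> > (0::real)"
  obtains C where "\<And>Q :: complex^'m^'m. posdef Q \<Longrightarrow> ln (Re (det Q)) \<le> C + \<epsilon> * norm Q"
proof -
  define m where "m = real CARD('m)"
  have "m > 0" by (simp add: m_def)
  have "ln (Re (det Q)) \<le> (ln (fact CARD('m)) - m * ln (\<epsilon> / m)) + \<epsilon> * norm Q"
    if "posdef Q" for Q :: "complex^'m^'m"
  proof -
    have pos: "0 < Re (det Q)" using det_posdef[OF that] by simp
    have "Q \<noteq> 0"
    proof
      assume "Q = 0"
      then have "Q *v axis undefined 1 = 0" by simp
      from posdef_ker[OF that this] have "axis undefined 1 = (0 :: complex^'m)" .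
      then show False by (simp add: axis_eq_0_iff)
    qed
    then have nQ: "norm Q > 0" by simp
    have "Re (det Q) \<le> fact CARD('m) * norm Q ^ CARD('m)"
      using norm_det_le[of Q] complex_Re_le_cmod[of "det Q"] by linarith
    then have "ln (Re (det Q)) \<le> ln (fact CARD('m) * norm Q ^ CARD('m))"
      using pos by (intro ln_mono) simp_all
    also have "\<dots> = ln (fact CARD('m)) + m * ln (norm Q)"
      using nQ by (subst ln_mult_pos) (simp_all add: ln_realpow m_def)
    finally have 1: "ln (Re (det Q)) \<le> ln (fact CARD('m)) + m * ln (norm Q)" .
    have "ln (\<epsilon> / m * norm Q) \<le> \<epsilon> / m * norm Q - 1"
      using assms \<open>m > 0\<close> nQ by (intro ln_le_minus_one) simp
    then have "ln (norm Q) \<le> \<epsilon> / m * norm Q - ln (\<epsilon> / m)"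
      using assms \<open>m > 0\<close> nQ by (subst (asm) ln_mult_pos) auto
    then have "m * ln (norm Q) \<le> m * (\<epsilon> / m * norm Q - ln (\<epsilon> / m))"
      using \<open>m > 0\<close> by (intro mult_left_mono) simp_all
    also have "\<dots> = \<epsilon> * norm Q - m * ln (\<epsilon> / m)"
      using \<open>m > 0\<close> by (simp add: right_diff_distrib)
    finally show ?thesis using 1 by linarith
  qed
  then show ?thesis using that by blast
qed

section \<open>Integration over the circle\<close>

abbreviation cis_measure :: "complex measure" where
  "cis_measure \<equiv> distr (uniform_measure lborel {0..2 * pi}) borel cis"

lemma cis_measurable [measurable]: "cis \<in> borel_measurable borel"
  by (intro borel_measurable_continuous_onI continuous_intros)

lemma space_circle_measure [simp]: "space circle_measure = UNIV"
  by (simp add: circle_measure_def)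

lemma emeasure_circle_measure: "emeasure circle_measure UNIV = 1"
proof -
  have "emeasure circle_measure UNIV = emeasure cis_measure UNIV"
    unfolding circle_measure_def by (subst emeasure_completion) auto
  also have "\<dots> = emeasure (uniform_measure lborel {0..2 * pi}) UNIV"
    by (subst emeasure_distr) auto
  also have "\<dots> = ennreal (2*pi) / ennreal (2*pi)"
    by (subst emeasure_uniform_measure) auto
  also have "\<dots> = 1" by (simp add: ennreal_divide_self)
  finally show ?thesis .
qed

interpretation circle: finite_measure circle_measure
  by standard (simp add: emeasure_circle_measure)

lemma measure_circle_measure: "measure circle_measure UNIV = 1"
  by (simp add: measure_def emeasure_circle_measure)

lemma AE_norm_1: "AE z in circle_measure. norm z = 1"
  unfolding circle_measure_def
  by (intro AE_completion, subst AE_distr_iff) auto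

text \<open>The circle measure is complete.  This is what makes boundary values, which are only almost
  everywhere limits, measurable.\<close>
lemma borel_measurable_circle_AE:
  fixes f g :: "complex \<Rightarrow> 'a::topological_space"
  assumes f: "f \<in> borel_measurable circle_measure" and eq: "AE z in circle_measure. f z = g z"
  shows "g \<in> borel_measurable circle_measure"
proof (rule measurableI)
  fix A :: "'a set" assume "A \<in> sets borel"
  then have "f -` A \<inter> space circle_measure \<in> sets circle_measure" using f by measurable
  then show "g -` A \<inter> space circle_measure \<in> sets circle_measure"
    unfolding circle_measure_def
  proof (rule completion.in_sets_AE[rotated])
    show "AE z in completion cis_measure.
        (z \<in> f -` A \<inter> space (completion cis_measure)) = (z \<in> g -` A \<inter> space (completion cis_measure))"
      using eq[unfolded circle_measure_def] by (rule eventually_mono) simp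
  qed auto
qed simp

lemma continuous_on_circle_cis:
  assumes "continuous_on (sphere 0 1) f"
  shows "continuous_on S (\<lambda>t. f (cis t))"
  by (rule continuous_on_compose2[OF assms]) (auto intro!: continuous_intros)

lemma AE_circle_extend: "AE z in circle_measure. indicator (sphere 0 1) z *\<^sub>R f z = (f z :: 'a::real_vector)"
  using AE_norm_1 by eventually_elim auto

lemma borel_extend:
  fixes f :: "complex \<Rightarrow> 'a::real_normed_vector"
  assumes "continuous_on (sphere 0 1) f"
  shows "(\<lambda>z. indicator (sphere 0 1) z *\<^sub>R f z) \<in> borel_measurable borel"
  using assms by (intro borel_measurable_continuous_on_indicator) auto

text \<open>Continuity is only given on the circle; off the circle, a null set, the function is replaced
  by 0.\<close>
lemma continuous_imp_measurable_circle:
  fixes f :: "complex \<Rightarrow> 'a::real_normed_vector"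
  assumes "continuous_on (sphere 0 1) f"
  shows "f \<in> borel_measurable circle_measure"
proof (rule borel_measurable_circle_AE[OF _ AE_circle_extend])
  show "(\<lambda>z. indicator (sphere 0 1) z *\<^sub>R f z) \<in> borel_measurable circle_measure"
    unfolding circle_measure_def
    by (rule measurable_completion) (use borel_extend[OF assms] in simp)
qed

lemma continuous_imp_bounded_circle:
  fixes f :: "complex \<Rightarrow> 'a::real_normed_vector"
  assumes "continuous_on (sphere 0 1) f"
  obtains K where "K \<ge> 0" "\<And>z. norm z = 1 \<Longrightarrow> norm (f z) \<le> K"
proof -
  have "bounded (f ` sphere 0 1)"
    by (intro compact_imp_bounded compact_continuous_image assms) simp
  then obtain K where "K > 0" "\<forall>x\<in>f ` sphere 0 1. norm x \<le> K" by (auto simp: bounded_pos)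
  then show ?thesis by (intro that[of K]) auto
qed

lemma continuous_imp_integrable_circle:
  fixes f :: "complex \<Rightarrow> 'a::{banach, second_countable_topology}"
  assumes "continuous_on (sphere 0 1) f"
  shows "integrable circle_measure f"
proof -
  obtain K where K: "\<And>z. norm z = 1 \<Longrightarrow> norm (f z) \<le> K"
    using continuous_imp_bounded_circle[OF assms] by blast
  show ?thesis
  proof (rule circle.integrable_const_bound)
    show "AE z in circle_measure. norm (f z) \<le> K"
      using AE_norm_1 by eventually_elim (rule K)
  qed (rule continuous_imp_measurable_circle[OF assms])
qed

lemma integral_circle_continuous:
  fixes f :: "complex \<Rightarrow> 'a::euclidean_space"
  assumes f: "continuous_on (sphere 0 1) f"
  shows "(LINT z|circle_measure. f z) = (1 / (2*pi)) *\<^sub>R integral {0..2*pi} (\<lambda>t. f (cis t))"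
proof -
  define g where "g z = indicator (sphere 0 1) z *\<^sub>R f z" for z
  have g: "g \<in> borel_measurable borel" unfolding g_def by (rule borel_extend[OF f])
  have gcis: "g (cis t) = f (cis t)" for t by (simp add: g_def)
  have "(LINT z|circle_measure. f z) = (LINT z|circle_measure. g z)"
  proof (rule integral_cong_AE)
    show "f \<in> borel_measurable circle_measure" by (rule continuous_imp_measurable_circle[OF f])
    show "g \<in> borel_measurable circle_measure"
      unfolding circle_measure_def by (rule measurable_completion) (use g in simp)
    show "AE z in circle_measure. f z = g z"
      unfolding g_def using AE_circle_extend[of f] by eventually_elim simp
  qed
  also have "\<dots> = (LINT z|cis_measure. g z)"
    unfolding circle_measure_def by (rule integral_completion) (use g in simp)
  also have "\<dots> = (LINT t|uniform_measure lborel {0..2*pi}. g (cis t))"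
    by (rule integral_distr) (use g in simp_all)
  also have "uniform_measure lborel {0..2*pi} =
      density lborel (\<lambda>t. ennreal (indicator {0..2*pi} t / (2*pi)))"
    unfolding uniform_measure_def
    by (intro arg_cong[of _ _ "density lborel"] ext)
       (simp add: divide_ennreal[of 1, simplified] split: split_indicator)
  also have "(LINT t|\<dots>. g (cis t)) = (LINT t|lborel. (indicator {0..2*pi} t / (2*pi)) *\<^sub>R g (cis t))"
    by (rule integral_density) (use g in \<open>auto simp: measurable_compose[OF cis_measurable g]\<close>)
  also have "\<dots> = (LINT t|lborel. (1 / (2*pi)) *\<^sub>R (indicator {0..2*pi} t *\<^sub>R f (cis t)))"
    by (simp add: gcis)
  also have "\<dots> = (1 / (2*pi)) *\<^sub>R (LINT t:{0..2*pi}|lborel. f (cis t))"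
    unfolding set_lebesgue_integral_def by (rule integral_scaleR_right)
  also have "(LINT t:{0..2*pi}|lborel. f (cis t)) = integral {0..2*pi} (\<lambda>t. f (cis t))"
    unfolding set_integrable_def[symmetric]
    by (rule set_borel_integral_eq_integral)
       (simp add: set_integrable_def borel_integrable_compact continuous_on_circle_cis[OF f])
  finally show ?thesis .
qed

text \<open>Cauchy's integral formula at the centre, read in the angle.\<close>
lemma mean_value_circle:
  assumes "f holomorphic_on S" "cball 0 1 \<subseteq> S"
  shows "(LINT z|circle_measure. f z) = f 0"
proof -
  have hol: "f holomorphic_on cball 0 1" using assms holomorphic_on_subset by blast
  then have cont: "continuous_on (sphere 0 1) f"
    by (intro holomorphic_on_imp_continuous_on holomorphic_on_subset[OF hol]) auto
  have "((\<lambda>u. f u / (u - 0)) has_contour_integral (2 * of_real pi * \<i> * f 0)) (circlepath 0 1)"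
    by (rule Cauchy_integral_circlepath_simple[OF hol]) simp
  then have "((\<lambda>t. f (cis t) * \<i>) has_integral (2 * of_real pi * \<i> * f 0)) {0..2*pi}"
    by (simp add: circlepath_def has_contour_integral_part_circlepath_iff)
  from has_integral_mult_left[OF this, of "- \<i>"]
  have "((\<lambda>t. f (cis t)) has_integral (2 * of_real pi * f 0)) {0..2*pi}"
    by (simp add: mult.assoc mult.left_commute[of \<i>])
  then have "integral {0..2*pi} (\<lambda>t. f (cis t)) = 2 * of_real pi * f 0" by (rule integral_unique)
  then show ?thesis
    unfolding integral_circle_continuous[OF cont] by (simp add: scaleR_conv_of_real)
qed

section \<open>Integrals with values in the extended reals\<close>

lemma ext_integral_integrable:
  assumes "integrable M f"
  shows "ext_integral M f = ereal (integral\<^sup>L M f)"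
proof -
  have "(\<integral>\<^sup>+x. ennreal (f x) \<partial>M) \<noteq> \<infinity>" "(\<integral>\<^sup>+x. ennreal (- f x) \<partial>M) \<noteq> \<infinity>"
    using assms by (auto simp: real_integrable_def)
  then show ?thesis
    unfolding ext_integral_def real_lebesgue_integral_def[OF assms]
    by (cases rule: ennreal2_cases[of "(\<integral>\<^sup>+x. ennreal (f x) \<partial>M)" "(\<integral>\<^sup>+x. ennreal (- f x) \<partial>M)"])
       (auto simp: enn2ereal_ennreal)
qed

text \<open>For a function bounded below the negative part has a finite integral, so adding a constant
  reduces the extended integral to one of a nonnegative function, to which Fatou's lemma applies.\<close>
lemma ext_integral_shift:
  assumes f [measurable]: "f \<in> borel_measurable circle_measure" and "K \<ge> 0"
    and below: "AE z in circle_measure. - K \<le> f z"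
  shows "ext_integral circle_measure f + ereal K = enn2ereal (\<integral>\<^sup>+z. ennreal (f z + K) \<partial>circle_measure)"
proof -
  let ?P = "\<integral>\<^sup>+z. ennreal (f z) \<partial>circle_measure"
  let ?N = "\<integral>\<^sup>+z. ennreal (- f z) \<partial>circle_measure"
  let ?S = "\<integral>\<^sup>+z. ennreal (f z + K) \<partial>circle_measure"
  have K1: "(\<integral>\<^sup>+z. ennreal K \<partial>circle_measure) = ennreal K"
    by (simp add: emeasure_circle_measure)
  have "?N \<le> (\<integral>\<^sup>+z. ennreal K \<partial>circle_measure)"
    by (rule nn_integral_mono_AE) (use below in \<open>eventually_elim, auto intro!: ennreal_leI\<close>)
  then have "?N \<noteq> top" unfolding K1 using neq_top_trans by force
  have "?S + ?N = (\<integral>\<^sup>+z. ennreal (f z + K) + ennreal (- f z) \<partial>circle_measure)"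
    by (rule nn_integral_add[symmetric]) auto
  also have "\<dots> = (\<integral>\<^sup>+z. ennreal (f z) + ennreal K \<partial>circle_measure)"
  proof (rule nn_integral_cong_AE)
    show "AE z in circle_measure. ennreal (f z + K) + ennreal (- f z) = ennreal (f z) + ennreal K"
      using below
    proof eventually_elim
      case (elim z)
      then show ?case using \<open>K \<ge> 0\<close>
        by (cases "f z \<ge> 0") (auto simp: ennreal_neg ennreal_plus[symmetric] simp del: ennreal_plus)
    qed
  qed
  also have "\<dots> = ?P + ennreal K"
    using \<open>K \<ge> 0\<close> by (subst nn_integral_add) (simp_all add: emeasure_circle_measure)
  finally have eq: "?S + ?N = ?P + ennreal K" .
  show ?thesis
    unfolding ext_integral_def using eq \<open>?N \<noteq> top\<close> \<open>K \<ge> 0\<close>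
    by (cases rule: ennreal3_cases[of ?P ?N ?S])
       (auto simp: enn2ereal_ennreal ennreal_plus[symmetric] ennreal_inj top_ereal_def simp del: ennreal_plus)
qed

lemma ext_integral_finite_imp_integrable:
  assumes f [measurable]: "f \<in> borel_measurable circle_measure" and "K \<ge> 0"
    and below: "AE z in circle_measure. - K \<le> f z"
    and fin: "ext_integral circle_measure f \<noteq> \<infinity>"
  shows "integrable circle_measure f"
proof -
  let ?S = "\<integral>\<^sup>+z. ennreal (f z + K) \<partial>circle_measure"
  have "ext_integral circle_measure f + ereal K \<noteq> \<infinity>" using fin by simp
  then have "?S \<noteq> top" unfolding ext_integral_shift[OF f \<open>K \<ge> 0\<close> below] by auto
  then have "integrable circle_measure (\<lambda>z. f z + K)"
    using below by (intro integrableI_nonneg) (auto simp: top.not_eq_extremum elim: eventually_mono)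
  from Bochner_Integration.integrable_diff[OF this, of "\<lambda>_. K"] show ?thesis by simp
qed

section \<open>Inverses of matrix functions\<close>

lemma matrix_inv_det_nz:
  fixes M :: "'a::field^'n^'n"
  assumes "det M \<noteq> 0"
  shows "M ** matrix_inv M = mat 1" "matrix_inv M ** M = mat 1"
proof -
  have "\<exists>M'. M ** M' = mat 1 \<and> M' ** M = mat 1"
    using assms by (simp add: invertible_det_nz[symmetric] invertible_def)
  from someI_ex[OF this] show "M ** matrix_inv M = mat 1" "matrix_inv M ** M = mat 1"
    by (simp_all add: matrix_inv_def)
qed

text \<open>Cramer's rule.  It carries holomorphy and continuity of a matrix function over to its inverse.\<close>
lemma matrix_inv_entry:
  fixes M :: "'a::field^'n^'n"
  assumes "det M \<noteq> 0"
  shows "matrix_inv M $ i $ j = det (\<chi> a c. if c = i then axis j 1 $ a else M $ a $ c) / det M"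
proof -
  have "M *v (matrix_inv M *v axis j 1) = axis j 1"
    by (simp add: matrix_vector_mul_assoc matrix_inv_det_nz[OF assms])
  then have "matrix_inv M *v axis j 1
      = (\<chi> k. det (\<chi> a c. if c = k then axis j 1 $ a else M $ a $ c) / det M)"
    by (simp add: cramer[OF assms])
  then have "(matrix_inv M *v axis j 1) $ i
      = det (\<chi> a c. if c = i then axis j 1 $ a else M $ a $ c) / det M"
    by simp
  moreover have "(X *v axis j 1) $ i = X $ i $ j" for X :: "'a^'n^'n"
    by (simp add: matrix_vector_mult_def axis_def if_distrib cong: if_cong)
  ultimately show ?thesis by simp
qed

lemma holomorphic_on_det:
  assumes "\<And>i j. (\<lambda>z. M z $ i $ j) holomorphic_on S"
  shows "(\<lambda>z. det (M z)) holomorphic_on S"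
  unfolding det_def by (intro holomorphic_intros assms)

lemma continuous_on_det:
  fixes M :: "'b::topological_space \<Rightarrow> complex^'n^'n"
  assumes "continuous_on S M"
  shows "continuous_on S (\<lambda>z. det (M z))"
  unfolding det_def by (intro continuous_intros assms)

lemma continuous_on_matrixI:
  fixes M :: "'b::topological_space \<Rightarrow> complex^'n^'m"
  assumes "\<And>i j. continuous_on S (\<lambda>z. M z $ i $ j)"
  shows "continuous_on S M"
proof -
  have "continuous_on S (\<lambda>z. \<chi> i j. M z $ i $ j)"
    by (intro continuous_on_vec_lambda assms)
  then show ?thesis by simp
qed

lemma holomorphic_on_matrix_inv:
  assumes "\<And>i j. (\<lambda>z. M z $ i $ j) holomorphic_on S" and "\<And>z. z \<in> S \<Longrightarrow> det (M z) \<noteq> 0"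
  shows "(\<lambda>z. matrix_inv (M z) $ i $ j) holomorphic_on S"
proof (rule holomorphic_transform)
  show "(\<lambda>z. det (\<chi> a c. if c = i then axis j 1 $ a else M z $ a $ c) / det (M z)) holomorphic_on S"
  proof (intro holomorphic_on_divide holomorphic_on_det assms)
    fix a c show "(\<lambda>z. (\<chi> a c. if c = i then axis j 1 $ a else M z $ a $ c) $ a $ c) holomorphic_on S"
      using assms(1) by (cases "c = i") auto
  qed
qed (simp add: matrix_inv_entry assms)

lemma continuous_on_matrix_inv:
  fixes M :: "'b::topological_space \<Rightarrow> complex^'n^'n"
  assumes M: "continuous_on S M" and nz: "\<And>z. z \<in> S \<Longrightarrow> det (M z) \<noteq> 0"
  shows "continuous_on S (\<lambda>z. matrix_inv (M z))"
proof (rule continuous_on_matrixI)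
  fix i j
  have "continuous_on S (\<lambda>z. det (\<chi> a c. if c = i then axis j 1 $ a else M z $ a $ c) / det (M z))"
  proof (rule continuous_on_divide[OF continuous_on_det[OF continuous_on_matrixI] continuous_on_det[OF M]])
    show "\<forall>z\<in>S. det (M z) \<noteq> 0" using nz by blast
    fix a c show "continuous_on S (\<lambda>z. (\<chi> a c. if c = i then axis j 1 $ a else M z $ a $ c) $ a $ c)"
      using M by (cases "c = i") (auto intro!: continuous_intros)
  qed
  then show "continuous_on S (\<lambda>z. matrix_inv (M z) $ i $ j)"
    by (rule continuous_on_eq) (simp add: matrix_inv_entry nz)
qed

lemmas continuous_on_matrix_mult =
  bounded_bilinear.continuous_on[OF bounded_bilinear_matrix_mult]
lemmas continuous_on_ctranspose =
  bounded_linear.continuous_on[OF bounded_linear_ctranspose]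

lemma continuous_on_mat: "continuous_on S f \<Longrightarrow> continuous_on S (\<lambda>z. mat (f z) :: complex^'n^'n)"
  by (rule continuous_on_matrixI) (rename_tac i j, case_tac "i = j", simp_all add: mat_def)

lemma mat_mult_vec: "mat (z::complex) *v v = z *s v"
  by (simp add: vec_eq_iff matrix_vector_mult_def mat_def if_distrib if_distribR cong: if_cong)

lemma mat_mult_entry:
  "(mat (z::complex) ** X) $ i $ j = z * X $ i $ j" "(X ** mat z) $ i $ j = z * X $ i $ j"
  by (simp_all add: matrix_matrix_mult_def mat_def if_distrib if_distribR mult.commute cong: if_cong)

lemma mat_mult_commute: "(X :: complex^'n^'m) ** mat z = mat z ** X"
  by (simp add: vec_eq_iff mat_mult_entry)

lemma mat_mult_left_commute: "(X :: complex^'n^'m) ** (mat z ** Y) = mat z ** (X ** Y)"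
  unfolding matrix_mul_assoc mat_mult_commute[of X] ..

section \<open>The maximum entropy density\<close>

lemma norm_vector_scalar: "norm (c *s v :: complex^'n) = cmod c * norm v"
proof -
  have "(norm (c *s v))\<^sup>2 = Re (cnj c * c * cdot v v)"
    by (simp add: power2_norm_eq_inner Re_cdot[symmetric] cdot_linear_left cdot_linear_right algebra_simps)
  also have "cnj c * c = complex_of_real ((cmod c)\<^sup>2)"
    unfolding complex_norm_square by simp
  also have "Re (complex_of_real ((cmod c)\<^sup>2) * cdot v v) = (cmod c * norm v)\<^sup>2"
    by (simp add: Re_cdot power_mult_distrib power2_norm_eq_inner del: of_real_power)
  finally show ?thesis by (simp add: power2_eq_iff_nonneg)
qed

lemma stable_matrix_det:
  assumes "stable_matrix A" "1 \<le> norm z"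
  shows "det (mat z - cmat A) \<noteq> 0"
  unfolding det_nz_iff_ker
proof (intro allI impI)
  fix v assume "(mat z - cmat A) *v v = 0"
  then have "cmat A *v v = z *s v"
    by (simp add: matrix_vector_mult_diff_rdistrib mat_mult_vec)
  then show "v = 0" using assms by (force simp: stable_matrix_def)
qed

text \<open>The second part recognizes products \<open>G V\<close> without inverting \<open>zI - A\<close> again.\<close>
lemma transfer_fn_equation:
  assumes "stable_matrix A" "norm z = 1"
  shows "(mat z - cmat A) ** transfer_fn A B z = cmat B"
    and "(mat z - cmat A) ** X = cmat B ** V \<Longrightarrow> transfer_fn A B z ** V = X"
proof -
  have nz: "det (mat z - cmat A) \<noteq> 0" using stable_matrix_det[OF assms(1)] assms(2) by simp
  show "(mat z - cmat A) ** transfer_fn A B z = cmat B"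
    by (simp add: transfer_fn_def matrix_mul_assoc matrix_inv_det_nz[OF nz])
  assume "(mat z - cmat A) ** X = cmat B ** V"
  then have "matrix_inv (mat z - cmat A) ** ((mat z - cmat A) ** X) = transfer_fn A B z ** V"
    by (simp add: transfer_fn_def matrix_mul_assoc)
  then show "transfer_fn A B z ** V = X"
    by (simp add: matrix_mul_assoc matrix_inv_det_nz[OF nz])
qed

lemma continuous_on_transfer_fn:
  assumes "stable_matrix A"
  shows "continuous_on (sphere 0 1) (transfer_fn A B)"
  unfolding transfer_fn_def
  by (intro continuous_on_matrix_mult continuous_on_matrix_inv continuous_on_diff continuous_on_mat
      continuous_on_id continuous_on_const stable_matrix_det assms) simp

text \<open>\<open>P = B (B\<^sup>T B)\<^sup>-\<^sup>1 B\<^sup>T\<close> is the orthogonal projection onto the range of \<open>B\<close>.  Since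
  \<open>(I - P) B = 0\<close>, compressing the feasibility equation by \<open>I - P\<close> removes its right-hand side, and
  \<open>(I - P) A A\<^sup>T (I - P) = I - P\<close> is left.\<close>
lemma range_projection:
  fixes A :: "real^'n^'n" and B :: "real^'m^'n" and H :: "real^'n^'m"
  assumes "rank B = CARD('m)"
    and feas: "mat 1 - A ** transpose A = B ** H + transpose H ** transpose B"
  obtains L P where "L ** B = mat 1" "P = B ** L" "transpose P = P" "P ** P = P"
    "(A - P ** A) ** transpose (A - P ** A) = mat 1 - P"
proof -
  define N where "N = transpose B ** B"
  have "det N \<noteq> 0"
    unfolding det_nz_iff_ker
  proof (intro allI impI)
    fix x assume "N *v x = 0"
    then have "(B *v x) \<bullet> (B *v x) = 0"
      by (simp add: N_def dot_lmul_matrix[symmetric] matrix_vector_mul_assoc[symmetric]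
          flip: transpose_matrix_vector)
    then have "B *v x = 0" by simp
    then show "x = 0"
      using assms(1) full_rank_injective[of B] by (metis injD matrix_vector_mult_0_right)
  qed
  note inv = matrix_inv_det_nz[OF this]
  define C where "C = matrix_inv N"
  have "transpose N = N" by (simp add: N_def matrix_transpose_mul)
  then have "N ** transpose C = mat 1"
    using inv(2) by (metis C_def matrix_transpose_mul transpose_mat)
  then have "transpose C = C"
    using inv(2) by (metis C_def matrix_mul_assoc matrix_mul_lid matrix_mul_rid)
  define L where "L = C ** transpose B"
  define P where "P = B ** L"
  have LB: "L ** B = mat 1" using inv(2) by (simp add: L_def C_def N_def matrix_mul_assoc)
  have tP: "transpose P = P"
    by (simp add: P_def L_def matrix_transpose_mul \<open>transpose C = C\<close> matrix_mul_assoc)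
  have PB: "P ** B = B" by (simp add: P_def matrix_mul_assoc[symmetric] LB)
  have BP: "transpose B ** P = transpose B" using PB tP by (metis matrix_transpose_mul)
  have PP: "P ** P = P" using PB by (metis P_def matrix_mul_assoc)
  have "(A - P ** A) ** transpose (A - P ** A) = (mat 1 - P) ** (A ** transpose A) ** (mat 1 - P)"
  proof -
    have "A - P ** A = (mat 1 - P) ** A" by (simp add: matrix_diff_rdistrib)
    moreover have "transpose (mat 1 - P) = mat 1 - P"
      using tP by (simp add: vec_eq_iff transpose_def mat_def)
    ultimately show ?thesis by (simp add: matrix_transpose_mul matrix_mul_assoc)
  qed
  also have "A ** transpose A = mat 1 - (B ** H + transpose H ** transpose B)"
    using feas by (simp add: algebra_simps)
  also have "(mat 1 - P) ** \<dots> ** (mat 1 - P) = mat 1 - P"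
  proof -
    have 1: "(mat 1 - P) ** (B ** H) = 0"
      by (simp add: matrix_diff_rdistrib matrix_mul_assoc PB)
    have 2: "(transpose H ** transpose B) ** (mat 1 - P) = 0"
      by (simp add: matrix_diff_ldistrib matrix_mul_assoc[symmetric] BP)
    have "(mat 1 - P) ** (mat 1 - (B ** H + transpose H ** transpose B)) ** (mat 1 - P)
      = (mat 1 - P) ** (mat 1 - P) - ((mat 1 - P) ** (B ** H)) ** (mat 1 - P)
        - (mat 1 - P) ** ((transpose H ** transpose B) ** (mat 1 - P))"
      by (simp only: matrix_diff_ldistrib matrix_diff_rdistrib matrix_add_ldistrib matrix_add_rdistrib
          matrix_mul_assoc matrix_mul_rid matrix_mul_lid) (simp add: algebra_simps)
    also have "\<dots> = mat 1 - P"
      unfolding 1 2 by (simp add: matrix_diff_ldistrib matrix_diff_rdistrib PP)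
    finally show ?thesis .
  qed
  finally show ?thesis by (intro that[OF LB P_def tP PP])
qed

text \<open>Stability of \<open>Z = (I - P) A\<close>.  If \<open>v = w Z\<^sup>T v\<close> with \<open>|w| \<le> 1\<close>, then
  \<open>|v|\<^sup>2 \<le> |Z\<^sup>T v|\<^sup>2 = |v|\<^sup>2 - |P v|\<^sup>2\<close>, so \<open>P v = 0\<close> and \<open>v = w A\<^sup>T v\<close>, contrary to the stability of \<open>A\<close>.\<close>
lemma closed_loop_det:
  fixes A P :: "real^'n^'n"
  assumes stable: "stable_matrix A" and tP: "transpose P = P" and PP: "P ** P = P"
    and ZZ: "Z ** transpose Z = mat 1 - P" and Z: "Z = A - P ** A" and "cmod w \<le> 1"
  shows "det (mat 1 - mat w ** cmat (transpose Z)) \<noteq> 0"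
  unfolding det_nz_iff_ker
proof (intro allI impI, rule ccontr)
  fix v :: "complex^'n"
  assume eq: "(mat 1 - mat w ** cmat (transpose Z)) *v v = 0" and "v \<noteq> 0"
  define u where "u = cmat (transpose Z) *v v"
  have v: "v = w *s u"
    using eq by (simp add: matrix_vector_mult_diff_rdistrib matrix_vector_mul_assoc[symmetric]
        mat_mult_vec u_def)
  then have "w \<noteq> 0" using \<open>v \<noteq> 0\<close> by auto
  have "norm v \<le> 1 * norm u"
    using \<open>cmod w \<le> 1\<close> unfolding v norm_vector_scalar by (intro mult_right_mono) auto
  then have le: "v \<bullet> v \<le> u \<bullet> u" by (simp add: norm_le)
  have form: "v \<bullet> ((cmat X ** cmat (transpose X)) *v v) = (cmat (transpose X) *v v) \<bullet> (cmat (transpose X) *v v)"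
    for X :: "real^'n^'n"
    by (simp only: Re_cdot[symmetric] matrix_vector_mul_assoc[symmetric] cdot_adjoint[of v "cmat X"] ctranspose_cmat)
  have "u \<bullet> u = v \<bullet> (cmat (mat 1 - P) *v v)"
    unfolding u_def form[symmetric] cmat_mult[symmetric] ZZ ..
  also have "\<dots> = v \<bullet> v - v \<bullet> (cmat P *v v)"
    by (simp add: cmat_diff cmat_mat matrix_vector_mult_diff_rdistrib inner_diff_right)
  also have "v \<bullet> (cmat P *v v) = (cmat P *v v) \<bullet> (cmat P *v v)"
    using form[of P] by (simp add: tP cmat_mult[symmetric] PP)
  finally have "(cmat P *v v) \<bullet> (cmat P *v v) \<le> 0" using le by simp
  then have Pv: "cmat P *v v = 0" by (metis inner_ge_zero inner_eq_zero_iff order_antisym)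
  have "transpose Z = transpose A - transpose A ** P"
  proof -
    have "transpose Z = transpose A - transpose (P ** A)"
      unfolding Z by (simp add: vec_eq_iff transpose_def)
    then show ?thesis by (simp add: matrix_transpose_mul tP)
  qed
  then have "u = cmat (transpose A) *v v"
    by (simp add: u_def cmat_diff cmat_mult matrix_vector_mult_diff_rdistrib
        matrix_vector_mul_assoc[symmetric] Pv)
  then have "(mat (1/w) - cmat (transpose A)) *v v = 0"
    using \<open>w \<noteq> 0\<close> arg_cong[OF v, of "\<lambda>x. (1/w) *s x"]
    by (simp add: matrix_vector_mult_diff_rdistrib mat_mult_vec)
  then have "det (mat (1/w) - cmat (transpose A)) = 0"
    using \<open>v \<noteq> 0\<close> det_nz_iff_ker by blast
  moreover have "mat (1/w) - cmat (transpose A) = transpose (mat (1/w) - cmat A)"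
    by (simp add: vec_eq_iff transpose_def mat_def)
  ultimately have "det (mat (1/w) - cmat A) = 0" by (simp add: det_transpose)
  moreover have "1 \<le> norm (1/w)" using \<open>w \<noteq> 0\<close> \<open>cmod w \<le> 1\<close> by (simp add: norm_divide)
  ultimately show False using stable_matrix_det[OF stable] by blast
qed

text \<open>On the circle let \<open>R = (zI - Z)\<^sup>-\<^sup>1\<close> with \<open>Z = (I - P) A\<close>.  From \<open>zI - A = (zI - Z) - P A\<close> and
  \<open>P = B L\<close> one gets \<open>(zI - A) R P = B V\<close> with \<open>V = L (I - A R P)\<close>, that is, \<open>G V = R P\<close>; the right
  inverse \<open>Y = B (I + L A G)\<close> of \<open>V\<close> is found in the same way.  For the integral, write
  \<open>X = (I - z Z\<^sup>*)\<^sup>-\<^sup>1\<close>, so that \<open>R\<close> is the conjugate of \<open>z\<close> times \<open>X\<^sup>*\<close>.  The equation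
  \<open>P = I - Z Z\<^sup>*\<close> gives \<open>R P R\<^sup>* = X\<^sup>* P X = X + X\<^sup>* - I\<close>, and since \<open>X\<close> is analytic on the closed
  disc with value \<open>I\<close> at 0, the mean value property yields the integral \<open>I\<close>.\<close>
lemma maximum_entropy_factor:
  fixes A :: "real^'n^'n" and B :: "real^'m^'n" and H :: "real^'n^'m"
  assumes stable: "stable_matrix A" and "rank B = CARD('m)"
    and "mat 1 - A ** transpose A = B ** H + transpose H ** transpose B"
  obtains V :: "complex \<Rightarrow> complex^'n^'m" and Y :: "complex \<Rightarrow> complex^'m^'n" where
    "continuous_on (sphere 0 1) V" "continuous_on (sphere 0 1) Y"
    "\<And>z. norm z = 1 \<Longrightarrow> V z ** Y z = mat 1"
    "(LINT z|circle_measure. (transfer_fn A B z ** V z) ** ctranspose (transfer_fn A B z ** V z)) = mat 1"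
proof -
  obtain L P where LB: "L ** B = mat 1" and P: "P = B ** L" and tP: "transpose P = P"
    and PP: "P ** P = P" and ZZ: "(A - P ** A) ** transpose (A - P ** A) = mat 1 - P"
    by (rule range_projection[OF assms(2,3)])
  define Z where "Z = A - P ** A"
  define a b l p \<zeta> where "a = cmat A" and "b = cmat B" and "l = cmat L" and "p = cmat P" and "\<zeta> = cmat Z"
  have lb: "l ** b = mat 1" using LB by (simp add: l_def b_def cmat_mult[symmetric] cmat_mat)
  have p: "p = b ** l" by (simp add: p_def b_def l_def P cmat_mult)
  have ps: "ctranspose p = p" by (simp add: p_def ctranspose_cmat tP)
  have pp: "p ** p = p" by (simp add: p_def PP cmat_mult[symmetric])
  have pb: "p ** b = b" by (simp add: p matrix_mul_assoc[symmetric] lb)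
  have \<zeta>: "\<zeta> = a - p ** a" by (simp add: \<zeta>_def Z_def a_def p_def cmat_diff cmat_mult)
  have \<zeta>\<zeta>: "\<zeta> ** ctranspose \<zeta> = mat 1 - p"
    unfolding \<zeta>_def p_def Z_def ctranspose_cmat cmat_mult[symmetric] ZZ by (simp add: cmat_diff cmat_mat)
  define D where "D z = mat 1 - mat z ** ctranspose \<zeta>" for z
  define X where "X z = matrix_inv (D z)" for z
  have det: "det (D z) \<noteq> 0" if "cmod z \<le> 1" for z
    unfolding D_def \<zeta>_def ctranspose_cmat
    by (rule closed_loop_det[OF stable tP PP _ Z_def that]) (use ZZ in \<open>simp add: Z_def\<close>)
  have DX: "D z ** X z = mat 1" "X z ** D z = mat 1" if "cmod z \<le> 1" for z
    using matrix_inv_det_nz[OF det[OF that]] by (simp_all add: X_def)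
  have contD: "continuous_on S D" for S
    unfolding D_def
    by (intro continuous_on_diff continuous_on_const continuous_on_matrix_mult continuous_on_mat continuous_on_id)
  have contX: "continuous_on (sphere 0 1) X"
    unfolding X_def by (intro continuous_on_matrix_inv contD det) simp
  have intX: "(LINT z|circle_measure. X z) = mat 1"
  proof -
    have "(LINT z|circle_measure. X z) $ i $ j = X 0 $ i $ j" for i j
    proof -
      have "(LINT z|circle_measure. X z) $ i $ j = (LINT z|circle_measure. X z $ i $ j)"
      proof -
        have bl: "bounded_linear (\<lambda>M :: complex^'n^'n. M $ i $ j)"
          by (rule bounded_linear_compose[OF bounded_linear_vec_nth bounded_linear_vec_nth])
        show ?thesis
          by (rule integral_bounded_linear[OF bl continuous_imp_integrable_circle[OF contX], symmetric])
      qed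
      also have "\<dots> = X 0 $ i $ j"
      proof (rule mean_value_circle[OF _ subset_refl])
        have "(\<lambda>z. D z $ i $ j) holomorphic_on cball 0 1" for i j
          unfolding D_def vector_minus_component mat_mult_entry by (intro holomorphic_intros)
        then show "(\<lambda>z. X z $ i $ j) holomorphic_on cball 0 1"
          unfolding X_def by (rule holomorphic_on_matrix_inv) (simp add: det)
      qed
      finally show ?thesis .
    qed
    moreover have "X 0 = mat 1"
      using DX(1)[of 0] by (simp add: D_def)
    ultimately show ?thesis by (simp add: vec_eq_iff)
  qed
  define R where "R z = mat (cnj z) ** ctranspose (X z)" for z
  define G where "G = transfer_fn A B"
  define V where "V z = l ** (mat 1 - a ** R z ** p)" for z
  define Y where "Y z = b ** (mat 1 + l ** a ** G z)" for z
  have contG: "continuous_on (sphere 0 1) G" unfolding G_def by (rule continuous_on_transfer_fn[OF stable])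
  have contR: "continuous_on (sphere 0 1) R"
    unfolding R_def by (intro continuous_on_matrix_mult continuous_on_mat continuous_on_ctranspose contX continuous_intros)
  have contV: "continuous_on (sphere 0 1) V"
    unfolding V_def by (intro continuous_on_matrix_mult continuous_on_diff continuous_on_const contR)
  have contY: "continuous_on (sphere 0 1) Y"
    unfolding Y_def by (intro continuous_on_matrix_mult continuous_on_add continuous_on_const contG)
  have GV: "G z ** V z = R z ** p" and VY: "V z ** Y z = mat 1"
    and GG: "(G z ** V z) ** ctranspose (G z ** V z) = X z + ctranspose (X z) - mat 1"
    if z: "norm z = 1" for z
  proof -
    have zz: "z * cnj z = 1" using z by (simp add: complex_norm_square[symmetric] flip: of_real_power)
    have Ds: "ctranspose (D z) = mat 1 - mat (cnj z) ** \<zeta>"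
      by (simp add: D_def ctranspose_diff ctranspose_mat ctranspose_mult mat_mult_commute[of \<zeta>])
    have zz': "mat z ** mat (cnj z) = (mat 1 :: complex^'n^'n)" "mat (cnj z) ** mat z = (mat 1 :: complex^'n^'n)"
      using zz unfolding vec_eq_iff mat_mult_entry by (simp_all add: mat_def mult.commute)
    have scal: "mat z ** (mat (cnj z) ** M) = M" "mat (cnj z) ** (mat z ** M) = M" for M :: "complex^'n^'n"
      by (simp_all add: matrix_mul_assoc zz')
    have zD: "mat z - \<zeta> = mat z ** ctranspose (D z)"
      by (simp add: Ds matrix_diff_ldistrib scal)
    have DXs: "ctranspose (D z) ** ctranspose (X z) = mat 1" "ctranspose (X z) ** ctranspose (D z) = mat 1"
      using DX[of z] z by (simp_all add: ctranspose_mult[symmetric] ctranspose_mat)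
    have DR: "(mat z - \<zeta>) ** R z = mat 1"
    proof -
      have "(mat z - \<zeta>) ** R z = mat z ** (mat (cnj z) ** (ctranspose (D z) ** ctranspose (X z)))"
        unfolding zD R_def matrix_mul_assoc[symmetric] mat_mult_left_commute[of "ctranspose (D z)"] ..
      then show ?thesis by (simp add: scal DXs zz')
    qed
    then have RD: "R z ** (mat z - \<zeta>) = mat 1" by (rule matrix_left_right_inverse[THEN iffD1])
    have split: "mat z - a = (mat z - \<zeta>) - p ** a" by (simp add: \<zeta>)
    show GV: "G z ** V z = R z ** p"
      unfolding G_def
    proof (rule transfer_fn_equation(2)[OF stable z])
      have "(mat z - a) ** (R z ** p) = p - p ** a ** R z ** p"
        unfolding split matrix_diff_rdistrib[of "mat z - \<zeta>"] by (simp add: matrix_mul_assoc DR)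
      also have "\<dots> = b ** V z"
        by (simp add: V_def p matrix_diff_ldistrib matrix_mul_assoc)
      finally show "(mat z - cmat A) ** (R z ** p) = cmat B ** V z" by (simp add: a_def b_def)
    qed
    have "R z ** (p ** a) ** G z = G z - R z ** b"
    proof -
      have distr: "R z ** (M - N) ** G z = (R z ** M) ** G z - R z ** (N ** G z)" for M N
        by (simp add: matrix_diff_ldistrib matrix_diff_rdistrib matrix_mul_assoc)
      have "p ** a = (mat z - \<zeta>) - (mat z - a)" by (simp add: \<zeta>)
      then have "R z ** (p ** a) ** G z = (R z ** (mat z - \<zeta>)) ** G z - R z ** ((mat z - a) ** G z)"
        by (simp only: distr)
      then show ?thesis
        using transfer_fn_equation(1)[OF stable z, of B] by (simp add: RD G_def a_def b_def)
    qed
    then have RG: "R z ** b ** (l ** a ** G z) = G z - R z ** b" by (simp add: p matrix_mul_assoc)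
    have "V z ** b = mat 1 - l ** a ** (R z ** b)"
    proof -
      have "V z ** b = l ** b - l ** a ** R z ** (p ** b)"
        by (simp add: V_def matrix_diff_ldistrib matrix_diff_rdistrib matrix_mul_assoc)
      then show ?thesis by (simp add: lb pb matrix_mul_assoc)
    qed
    then have "V z ** Y z = (mat 1 - l ** a ** (R z ** b)) ** (mat 1 + l ** a ** G z)"
      by (simp add: Y_def matrix_mul_assoc)
    also have "\<dots> = mat 1 + l ** a ** G z - l ** a ** (R z ** b) - l ** a ** (R z ** b ** (l ** a ** G z))"
      by (simp add: matrix_diff_rdistrib matrix_add_ldistrib matrix_mul_assoc algebra_simps)
    also have "\<dots> = mat 1" unfolding RG by (simp add: matrix_diff_ldistrib)
    finally show "V z ** Y z = mat 1" .
    have DD: "ctranspose (D z) ** D z = mat 1 - mat z ** ctranspose \<zeta> - mat (cnj z) ** \<zeta> + \<zeta> ** ctranspose \<zeta>"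
    proof -
      have "ctranspose (D z) ** D z = mat 1 - mat z ** ctranspose \<zeta> - mat (cnj z) ** \<zeta>
          + (mat (cnj z) ** \<zeta>) ** (mat z ** ctranspose \<zeta>)"
        unfolding Ds unfolding D_def
        by (simp add: matrix_diff_ldistrib matrix_diff_rdistrib matrix_mul_assoc algebra_simps)
      also have "(mat (cnj z) ** \<zeta>) ** (mat z ** ctranspose \<zeta>) = mat (cnj z) ** (mat z ** (\<zeta> ** ctranspose \<zeta>))"
        unfolding matrix_mul_assoc[symmetric] mat_mult_left_commute[of \<zeta>] ..
      also have "\<dots> = \<zeta> ** ctranspose \<zeta>" by (rule scal)
      finally show ?thesis .
    qed
    have "p = ctranspose (D z) + D z - ctranspose (D z) ** D z"
      unfolding DD \<zeta>\<zeta> unfolding Ds unfolding D_def by simp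
    then have "ctranspose (X z) ** p ** X z
        = ctranspose (X z) ** (ctranspose (D z) + D z - ctranspose (D z) ** D z) ** X z" by simp
    also have "\<dots> = (ctranspose (X z) ** ctranspose (D z)) ** X z + ctranspose (X z) ** (D z ** X z)
          - (ctranspose (X z) ** ctranspose (D z)) ** (D z ** X z)"
      by (simp only: matrix_add_ldistrib matrix_add_rdistrib matrix_diff_ldistrib matrix_diff_rdistrib matrix_mul_assoc)
    also have "\<dots> = X z + ctranspose (X z) - mat 1" using DX[of z] z by (simp add: DXs)
    finally have XpX: "ctranspose (X z) ** p ** X z = X z + ctranspose (X z) - mat 1" .
    have "(G z ** V z) ** ctranspose (G z ** V z) = R z ** (p ** p) ** ctranspose (R z)"
      unfolding GV by (simp add: ctranspose_mult ps matrix_mul_assoc)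
    also have "\<dots> = mat (cnj z) ** ((ctranspose (X z) ** p ** X z) ** mat z)"
      by (simp add: pp R_def ctranspose_mult ctranspose_mat matrix_mul_assoc)
    also have "\<dots> = mat (cnj z) ** (mat z ** (ctranspose (X z) ** p ** X z))"
      unfolding mat_mult_commute[of "ctranspose (X z) ** p ** X z"] ..
    also have "\<dots> = ctranspose (X z) ** p ** X z" by (rule scal)
    finally show "(G z ** V z) ** ctranspose (G z ** V z) = X z + ctranspose (X z) - mat 1"
      unfolding XpX .
  qed
  have "(LINT z|circle_measure. (G z ** V z) ** ctranspose (G z ** V z))
      = (LINT z|circle_measure. X z + ctranspose (X z) - mat 1)"
  proof (rule integral_cong_AE)
    show "AE z in circle_measure. (G z ** V z) ** ctranspose (G z ** V z) = X z + ctranspose (X z) - mat 1"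
      using AE_norm_1 by eventually_elim (rule GG)
  qed (intro continuous_imp_measurable_circle continuous_on_matrix_mult continuous_on_ctranspose
      continuous_on_diff continuous_on_add continuous_on_const contG contV contX)+
  also have "\<dots> = mat 1"
  proof -
    have iX: "integrable circle_measure X" by (rule continuous_imp_integrable_circle[OF contX])
    have "(LINT z|circle_measure. ctranspose (X z)) = ctranspose (LINT z|circle_measure. X z)"
      by (rule integral_bounded_linear[OF bounded_linear_ctranspose iX])
    moreover have "integrable circle_measure (\<lambda>z. ctranspose (X z))"
      by (rule integrable_bounded_linear[OF bounded_linear_ctranspose iX])
    ultimately show ?thesis
      using iX by (simp add: intX ctranspose_mat measure_circle_measure)
  qed
  finally show ?thesis
    using that[OF contV contY VY] by (simp add: G_def)
qed

section \<open>Boundary values of the spectral factor\<close>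

lemma borel_measurable_matrix_mult:
  fixes f :: "'a \<Rightarrow> complex^'n^'m" and g :: "'a \<Rightarrow> complex^'k^'n"
  assumes "f \<in> borel_measurable M" "g \<in> borel_measurable M"
  shows "(\<lambda>x. f x ** g x) \<in> borel_measurable M"
proof (rule borel_measurable_continuous_Pair[OF assms])
  show "continuous_on UNIV (\<lambda>x :: (complex^'n^'m) \<times> (complex^'k^'n). fst x ** snd x)"
    by (intro continuous_on_matrix_mult continuous_intros)
qed

lemma borel_measurable_ctranspose:
  "f \<in> borel_measurable M \<Longrightarrow> (\<lambda>x. ctranspose (f x :: complex^'n^'m)) \<in> borel_measurable M"
  by (rule borel_measurable_continuous_on[of ctranspose])
     (intro continuous_on_ctranspose continuous_on_id)

lemma borel_measurable_det:
  "f \<in> borel_measurable M \<Longrightarrow> (\<lambda>x. det (f x :: complex^'n^'n)) \<in> borel_measurable M"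
  by (rule borel_measurable_continuous_on[of det]) (intro continuous_on_det continuous_on_id)

text \<open>The boundary function is almost everywhere the limit of the continuous functions
  \<open>z \<mapsto> F ((1 + 1/(n+1)) z)\<close>.\<close>
lemma stable_function_measurable:
  fixes F :: "complex \<Rightarrow> complex^'m^'m"
  assumes "stable_function F"
  shows "F \<in> borel_measurable circle_measure"
proof -
  define r :: "nat \<Rightarrow> real" where "r n = 1 + 1 / real (Suc n)" for n
  have r1: "r n > 1" for n by (simp add: r_def)
  have "(\<lambda>n. 1 + 1 / real (Suc n)) \<longlonglongrightarrow> 1 + 0"
    by (intro tendsto_add tendsto_const LIMSEQ_Suc[OF lim_1_over_n])
  then have "r \<longlonglongrightarrow> 1" by (simp add: r_def[abs_def])
  then have r: "filterlim r (at_right 1) sequentially"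
    by (rule filterlim_at_withinI) (use r1 in \<open>auto intro!: always_eventually simp: less_imp_neq[symmetric]\<close>)
  have contF: "continuous_on {z. 1 < norm z} F"
    using assms unfolding stable_function_def
    by (intro continuous_on_matrixI holomorphic_on_imp_continuous_on) auto
  have "continuous_on (sphere 0 1) (\<lambda>z. F (complex_of_real (r n) * z))" for n
    by (rule continuous_on_compose2[OF contF])
       (use r1[of n] in \<open>auto intro!: continuous_intros simp: norm_mult\<close>)
  then have "(\<lambda>z. lim (\<lambda>n. F (complex_of_real (r n) * z))) \<in> borel_measurable circle_measure"
    by (intro borel_measurable_lim_metric continuous_imp_measurable_circle)
  moreover have "AE z in circle_measure. lim (\<lambda>n. F (complex_of_real (r n) * z)) = F z"
  proof -
    have "AE z in circle_measure. ((\<lambda>r. F (complex_of_real r * z)) \<longlongrightarrow> F z) (at_right 1)"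
      using assms by (simp add: stable_function_def)
    then show ?thesis
      by eventually_elim (intro limI filterlim_compose[OF _ r])
  qed
  ultimately show ?thesis by (rule borel_measurable_circle_AE)
qed

lemma stable_function_bounded:
  fixes F :: "complex \<Rightarrow> complex^'m^'m"
  assumes "stable_function F"
  obtains K where "K \<ge> 0" "AE z in circle_measure. norm (F z) \<le> K"
proof -
  obtain K where "K > 0" and K: "\<And>z. 1 < norm z \<Longrightarrow> norm (F z) \<le> K"
    using assms by (auto simp: stable_function_def bounded_pos)
  have "AE z in circle_measure. ((\<lambda>r. F (complex_of_real r * z)) \<longlongrightarrow> F z) (at_right 1)"
    using assms by (simp add: stable_function_def)
  then have "AE z in circle_measure. norm (F z) \<le> K"
    using AE_norm_1
  proof eventually_elim
    case (elim z)
    have "\<forall>\<^sub>F r in at_right 1. norm (F (complex_of_real r * z)) \<le> K"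
      using eventually_at_right_less[of "1::real"]
      by eventually_elim (use elim(2) in \<open>auto intro!: K simp: norm_mult\<close>)
    then show ?case
      by (rule tendsto_upperbound[OF tendsto_norm[OF elim(1)]]) simp
  qed
  then show ?thesis using that[of K] \<open>K > 0\<close> by simp
qed

text \<open>Invertibility outside the closed disc passes to the boundary because the inverse has radial
  limits too.\<close>
lemma spectral_factor_inverse:
  assumes "stable_min_phase_factor W \<Psi>"
  shows "AE z in circle_measure. W z ** matrix_inv (W z) = mat 1"
proof -
  have "AE z in circle_measure. ((\<lambda>r. W (complex_of_real r * z)) \<longlongrightarrow> W z) (at_right 1)"
    using assms by (simp add: stable_min_phase_factor_def stable_function_def)
  moreover have "AE z in circle_measure.
      ((\<lambda>r. matrix_inv (W (complex_of_real r * z))) \<longlongrightarrow> matrix_inv (W z)) (at_right 1)"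
    using assms by (simp add: stable_min_phase_factor_def stable_function_def)
  ultimately show ?thesis
    using AE_norm_1
  proof eventually_elim
    case (elim z)
    have inv: "W w ** matrix_inv (W w) = mat 1" if "1 < norm w" for w
      using assms that
      by (intro matrix_inv_det_nz(1)) (simp add: stable_min_phase_factor_def invertible_det_nz)
    have "\<forall>\<^sub>F r in at_right 1. W (complex_of_real r * z) ** matrix_inv (W (complex_of_real r * z)) = mat 1"
      using eventually_at_right_less[of "1::real"]
      by eventually_elim (use elim(3) in \<open>auto intro!: inv simp: norm_mult\<close>)
    then have "((\<lambda>r. W (complex_of_real r * z) ** matrix_inv (W (complex_of_real r * z))) \<longlongrightarrow> mat 1) (at_right 1)"
      by (rule tendsto_eventually)
    from tendsto_unique[OF _ bounded_bilinear.tendsto[OF bounded_bilinear_matrix_mult elim(1,2)] this]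
    show ?case by simp
  qed
qed

section \<open>The range of \<open>\<Gamma>\<close>\<close>

lemma cont_density_span_continuous:
  "\<Phi> \<in> cont_density_span \<Longrightarrow> continuous_on (sphere 0 1) \<Phi>"
  by (auto simp: cont_density_span_def cont_densities_def intro!: continuous_intros)

lemma cont_density_span_add:
  assumes "\<Phi> \<in> cont_density_span" "\<Theta> \<in> cont_density_span"
  shows "(\<lambda>z. \<Phi> z + \<Theta> z) \<in> cont_density_span"
proof -
  obtain k :: nat and c X where 1: "\<Phi> = (\<lambda>z. \<Sum>i<k. c i *\<^sub>R X i z)" "\<forall>i<k. X i \<in> cont_densities"
    using assms(1) by (auto simp: cont_density_span_def)
  obtain l :: nat and d Y where 2: "\<Theta> = (\<lambda>z. \<Sum>i<l. d i *\<^sub>R Y i z)" "\<forall>i<l. Y i \<in> cont_densities"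
    using assms(2) by (auto simp: cont_density_span_def)
  define e where "e i = (if i < k then c i else d (i - k))" for i
  define Z where "Z i = (if i < k then X i else Y (i - k))" for i
  have split: "(\<Sum>i<k + n. f i) = (\<Sum>i<k. f i) + (\<Sum>i<n. f (k + i))" for n and f :: "nat \<Rightarrow> complex^'a^'a"
    by (induction n) (simp_all add: add.assoc)
  have "(\<lambda>z. \<Phi> z + \<Theta> z) = (\<lambda>z. \<Sum>i<k + l. e i *\<^sub>R Z i z)"
    unfolding split 1 2 by (simp add: e_def Z_def)
  moreover have "\<forall>i<k + l. Z i \<in> cont_densities" using 1(2) 2(2) by (simp add: Z_def)
  ultimately show ?thesis unfolding cont_density_span_def by blast
qed

lemma cont_density_span_scale:
  assumes "\<Phi> \<in> cont_density_span"
  shows "(\<lambda>z. r *\<^sub>R \<Phi> z) \<in> cont_density_span"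
proof -
  obtain k :: nat and c X where 1: "\<Phi> = (\<lambda>z. \<Sum>i<k. c i *\<^sub>R X i z)" "\<forall>i<k. X i \<in> cont_densities"
    using assms(1) by (auto simp: cont_density_span_def)
  have "(\<lambda>z. r *\<^sub>R \<Phi> z) = (\<lambda>z. \<Sum>i<k. (r * c i) *\<^sub>R X i z)"
    by (simp add: 1 scaleR_sum_right)
  then show ?thesis using 1(2)
    unfolding cont_density_span_def by (intro CollectI exI[of _ k] exI[of _ "\<lambda>i. r * c i"] exI[of _ X]) simp
qed

lemma zero_in_cont_density_span: "(\<lambda>z. 0) \<in> cont_density_span"
  unfolding cont_density_span_def by (intro CollectI exI[of _ 0]) simp

lemma Gamma_integrable:
  assumes "stable_matrix A" "\<Phi> \<in> cont_density_span"
  shows "integrable circle_measure (\<lambda>z. transfer_fn A B z ** \<Phi> z ** ctranspose (transfer_fn A B z))"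
  by (intro continuous_imp_integrable_circle continuous_on_matrix_mult continuous_on_ctranspose
      continuous_on_transfer_fn cont_density_span_continuous assms)

lemma subspace_range_Gamma:
  assumes "stable_matrix A"
  shows "subspace (range_Gamma A B)"
proof (rule subspaceI)
  show "0 \<in> range_Gamma A B"
    unfolding range_Gamma_def
    by (intro CollectI image_eqI[OF _ zero_in_cont_density_span])
       (simp add: Gamma_op_def linear_0[OF linear_cmat])
next
  fix X Y assume "X \<in> range_Gamma A B" "Y \<in> range_Gamma A B"
  then obtain \<Phi> \<Theta> where 1: "\<Phi> \<in> cont_density_span" "cmat X = Gamma_op A B \<Phi>"
    and 2: "\<Theta> \<in> cont_density_span" "cmat Y = Gamma_op A B \<Theta>"
    by (auto simp: range_Gamma_def)
  have "Gamma_op A B (\<lambda>z. \<Phi> z + \<Theta> z) = Gamma_op A B \<Phi> + Gamma_op A B \<Theta>"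
    unfolding Gamma_op_def
    using Gamma_integrable[OF assms 1(1)] Gamma_integrable[OF assms 2(1)]
    by (simp add: matrix_add_ldistrib matrix_add_rdistrib)
  then have "cmat (X + Y) = Gamma_op A B (\<lambda>z. \<Phi> z + \<Theta> z)"
    by (simp add: linear_add[OF linear_cmat] 1 2)
  then show "X + Y \<in> range_Gamma A B"
    using cont_density_span_add[OF 1(1) 2(1)] unfolding range_Gamma_def by blast
next
  fix r X assume "X \<in> range_Gamma A B"
  then obtain \<Phi> where 1: "\<Phi> \<in> cont_density_span" "cmat X = Gamma_op A B \<Phi>"
    by (auto simp: range_Gamma_def)
  have "Gamma_op A B (\<lambda>z. r *\<^sub>R \<Phi> z) = r *\<^sub>R Gamma_op A B \<Phi>"
    unfolding Gamma_op_def
    by (simp add: bounded_bilinear.scaleR_left[OF bounded_bilinear_matrix_mult]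
        bounded_bilinear.scaleR_right[OF bounded_bilinear_matrix_mult])
  then have "cmat (r *\<^sub>R X) = Gamma_op A B (\<lambda>z. r *\<^sub>R \<Phi> z)"
    by (simp add: linear_cmul[OF linear_cmat] 1)
  then show "r *\<^sub>R X \<in> range_Gamma A B"
    using cont_density_span_scale[OF 1(1)] unfolding range_Gamma_def by blast
qed

definition pullback :: "real^'n^'n \<Rightarrow> real^'m^'n \<Rightarrow> real^'n^'n \<Rightarrow> complex \<Rightarrow> complex^'m^'m" where
  "pullback A B \<Lambda> z = ctranspose (transfer_fn A B z) ** cmat \<Lambda> ** transfer_fn A B z"

lemma continuous_on_pullback:
  "stable_matrix A \<Longrightarrow> continuous_on (sphere 0 1) (pullback A B \<Lambda>)"
  unfolding pullback_def[abs_def]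
  by (intro continuous_on_matrix_mult continuous_on_ctranspose continuous_on_transfer_fn continuous_on_const)

text \<open>For \<open>E = \<integral> G \<Phi> G\<^sup>*\<close> the adjoint of \<open>\<Gamma>\<close> gives \<open>E \<bullet> \<Lambda> = \<integral> (G\<^sup>* \<Lambda> G) \<bullet> \<Phi>\<close>, and \<open>\<Phi>\<close> is bounded.\<close>
lemma range_Gamma_inner_le:
  fixes A :: "real^'n^'n" and B :: "real^'m^'n"
  assumes stable: "stable_matrix A" and "E \<in> range_Gamma A B"
  obtains K where "K \<ge> 0"
    "\<And>\<Lambda>. \<bar>E \<bullet> \<Lambda>\<bar> \<le> K * (LINT z|circle_measure. norm (pullback A B \<Lambda> z))"
proof -
  obtain \<Phi> where \<Phi>: "\<Phi> \<in> cont_density_span" and E: "cmat E = Gamma_op A B \<Phi>"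
    using assms(2) by (auto simp: range_Gamma_def)
  have cont\<Phi>: "continuous_on (sphere 0 1) \<Phi>" using \<Phi> by (rule cont_density_span_continuous)
  obtain K where "K \<ge> 0" and K: "\<And>z. norm z = 1 \<Longrightarrow> norm (\<Phi> z) \<le> K"
    using continuous_imp_bounded_circle[OF cont\<Phi>] by blast
  have "\<bar>E \<bullet> \<Lambda>\<bar> \<le> K * (LINT z|circle_measure. norm (pullback A B \<Lambda> z))" for \<Lambda>
  proof -
    have contP: "continuous_on (sphere 0 1) (pullback A B \<Lambda>)" by (rule continuous_on_pullback[OF stable])
    have "E \<bullet> \<Lambda> = cmat \<Lambda> \<bullet> cmat E" by (simp add: cmat_inner inner_commute)
    also have "\<dots> = (LINT z|circle_measure. cmat \<Lambda> \<bullet>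
        (transfer_fn A B z ** \<Phi> z ** ctranspose (transfer_fn A B z)))"
      unfolding E Gamma_op_def by (rule integral_inner_right[symmetric]) (rule Gamma_integrable[OF stable \<Phi>])
    also have "\<dots> = (LINT z|circle_measure. pullback A B \<Lambda> z \<bullet> \<Phi> z)"
      unfolding inner_matrix_mult_right[of "cmat \<Lambda>"]
      by (simp add: inner_matrix_mult_left pullback_def matrix_mul_assoc)
    finally have "\<bar>E \<bullet> \<Lambda>\<bar> \<le> (LINT z|circle_measure. \<bar>pullback A B \<Lambda> z \<bullet> \<Phi> z\<bar>)"
      using integral_abs_bound by metis
    also have "\<dots> \<le> (LINT z|circle_measure. K * norm (pullback A B \<Lambda> z))"
    proof (rule integral_mono_AE)
      show "AE z in circle_measure. \<bar>pullback A B \<Lambda> z \<bullet> \<Phi> z\<bar> \<le> K * norm (pullback A B \<Lambda> z)"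
        using AE_norm_1
      proof eventually_elim
        case (elim z)
        have "\<bar>pullback A B \<Lambda> z \<bullet> \<Phi> z\<bar> \<le> norm (pullback A B \<Lambda> z) * norm (\<Phi> z)"
          by (rule Cauchy_Schwarz_ineq2)
        also have "\<dots> \<le> norm (pullback A B \<Lambda> z) * K" by (intro mult_left_mono K elim) simp
        finally show ?case by (simp add: mult.commute)
      qed
    qed (intro continuous_imp_integrable_circle continuous_intros contP cont\<Phi>)+
    finally show ?thesis by simp
  qed
  then show ?thesis using that \<open>K \<ge> 0\<close> by blast
qed

text \<open>The coordinates of \<open>\<Lambda>\<close> in an orthonormal basis of the range are controlled by the preceding
  estimate.  In particular \<open>\<Lambda> \<mapsto> G\<^sup>* \<Lambda> G\<close> is injective on the range, up to null sets.\<close>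
lemma range_Gamma_norm_le:
  fixes A :: "real^'n^'n" and B :: "real^'m^'n"
  assumes stable: "stable_matrix A"
  obtains C where "C > 0"
    "\<And>\<Lambda>. \<Lambda> \<in> range_Gamma A B \<Longrightarrow> norm \<Lambda> \<le> C * (LINT z|circle_measure. norm (pullback A B \<Lambda> z))"
proof -
  obtain S where S: "S \<subseteq> range_Gamma A B" "pairwise orthogonal S" "\<And>x. x \<in> S \<Longrightarrow> norm x = 1"
    "independent S" "span S = range_Gamma A B"
    using orthonormal_basis_subspace[OF subspace_range_Gamma[OF stable]] by metis
  have "finite S" using S(4) by (rule independent_imp_finite)
  have "\<forall>E\<in>S. \<exists>K\<ge>0. \<forall>\<Lambda>. \<bar>E \<bullet> \<Lambda>\<bar> \<le> K * (LINT z|circle_measure. norm (pullback A B \<Lambda> z))"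
  proof
    fix E assume "E \<in> S"
    then have "E \<in> range_Gamma A B" using S(1) by blast
    from range_Gamma_inner_le[OF stable this] obtain k where "k \<ge> 0"
      "\<And>\<Lambda>. \<bar>E \<bullet> \<Lambda>\<bar> \<le> k * (LINT z|circle_measure. norm (pullback A B \<Lambda> z))" by blast
    then show "\<exists>K\<ge>0. \<forall>\<Lambda>. \<bar>E \<bullet> \<Lambda>\<bar> \<le> K * (LINT z|circle_measure. norm (pullback A B \<Lambda> z))"
      by blast
  qed
  then obtain K where K: "\<And>E. E \<in> S \<Longrightarrow> K E \<ge> 0"
    "\<And>E \<Lambda>. E \<in> S \<Longrightarrow> \<bar>E \<bullet> \<Lambda>\<bar> \<le> K E * (LINT z|circle_measure. norm (pullback A B \<Lambda> z))"
    by metis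
  have "norm \<Lambda> \<le> (sum K S + 1) * (LINT z|circle_measure. norm (pullback A B \<Lambda> z))"
    if "\<Lambda> \<in> range_Gamma A B" for \<Lambda>
  proof -
    let ?I = "LINT z|circle_measure. norm (pullback A B \<Lambda> z)"
    have "norm \<Lambda> = norm (\<Sum>E\<in>S. (E \<bullet> \<Lambda>) *\<^sub>R E)"
      using orthonormal_basis_expand[OF S(2,3) _ \<open>finite S\<close>] that S(5) by (simp add: inner_commute[of _ \<Lambda>])
    also have "\<dots> \<le> (\<Sum>E\<in>S. \<bar>E \<bullet> \<Lambda>\<bar>)"
      by (rule sum_norm_le) (simp add: S(3))
    also have "\<dots> \<le> (\<Sum>E\<in>S. K E * ?I)" by (intro sum_mono K)
    also have "\<dots> \<le> (sum K S + 1) * ?I" by (simp add: sum_distrib_right distrib_right)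
    finally show ?thesis .
  qed
  moreover have "sum K S + 1 > 0" using sum_nonneg[of S K] K(1) by force
  ultimately show ?thesis using that by blast
qed

section \<open>Coercivity of the dual functional\<close>

text \<open>\<open>U\<close> is the inverse of the spectral factor on the circle, \<open>K\<close> a common bound of both, and
  \<open>V V\<^sup>*\<close> a density with covariance \<open>I\<close>.  Coercivity of this density is expressed by the bounded
  right inverse \<open>Y\<close> of \<open>V\<close>.\<close>
locale dual_problem =
  fixes A :: "real^'n^'n" and B :: "real^'m^'n"
    and W U :: "complex \<Rightarrow> complex^'m^'m" and K :: real
    and V :: "complex \<Rightarrow> complex^'n^'m" and Y :: "complex \<Rightarrow> complex^'m^'n"
  assumes stable: "stable_matrix A" and K_nonneg: "0 \<le> K"
    and W: "W \<in> borel_measurable circle_measure" "AE z in circle_measure. norm (W z) \<le> K"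
    and U: "U \<in> borel_measurable circle_measure" "AE z in circle_measure. norm (U z) \<le> K"
    and WU: "AE z in circle_measure. W z ** U z = mat 1"
    and V: "continuous_on (sphere 0 1) V" and Y: "continuous_on (sphere 0 1) Y"
    and VY: "\<And>z. norm z = 1 \<Longrightarrow> V z ** Y z = mat 1"
    and identity: "(LINT z|circle_measure.
        (transfer_fn A B z ** V z) ** ctranspose (transfer_fn A B z ** V z)) = mat 1"
begin

abbreviation Q :: "real^'n^'n \<Rightarrow> complex \<Rightarrow> complex^'m^'m" where
  "Q \<equiv> dual_matrix A B W"

abbreviation loss :: "real^'n^'n \<Rightarrow> complex \<Rightarrow> real" where
  "loss \<Lambda> z \<equiv> trace \<Lambda> - ln (Re (det (Q \<Lambda> z)))"

lemma Q_eq: "Q \<Lambda> z = mat 1 + ctranspose (W z) ** pullback A B \<Lambda> z ** W z"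
  by (simp add: dual_matrix_def Let_def pullback_def ctranspose_mult matrix_mul_assoc)

lemma pullback_linear:
  "pullback A B (X + X') z = pullback A B X z + pullback A B X' z"
  "pullback A B (X - X') z = pullback A B X z - pullback A B X' z"
  "pullback A B (c *\<^sub>R X) z = c *\<^sub>R pullback A B X z"
  by (simp_all add: pullback_def linear_add[OF linear_cmat] linear_diff[OF linear_cmat] linear_cmul[OF linear_cmat]
      matrix_add_ldistrib matrix_add_rdistrib matrix_diff_ldistrib matrix_diff_rdistrib
      bounded_bilinear.scaleR_left[OF bounded_bilinear_matrix_mult]
      bounded_bilinear.scaleR_right[OF bounded_bilinear_matrix_mult])

lemma Q_midpoint: "Q ((1/2) *\<^sub>R (X + X')) z = (1/2) *\<^sub>R (Q X z + Q X' z)"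
proof -
  have "mat 1 = (1/2) *\<^sub>R (mat 1 + mat 1 :: complex^'m^'m)" by (simp add: scaleR_2[symmetric])
  then show ?thesis
    unfolding Q_eq
    by (simp add: pullback_linear matrix_add_ldistrib matrix_add_rdistrib scaleR_add_right
      bounded_bilinear.scaleR_left[OF bounded_bilinear_matrix_mult]
      bounded_bilinear.scaleR_right[OF bounded_bilinear_matrix_mult])
qed

lemma tendsto_Q:
  assumes "X \<longlonglongrightarrow> \<Lambda>"
  shows "(\<lambda>n. Q (X n) z) \<longlonglongrightarrow> Q \<Lambda> z"
  unfolding Q_eq pullback_def
  by (intro tendsto_add tendsto_const bounded_bilinear.tendsto[OF bounded_bilinear_matrix_mult]
      bounded_linear.tendsto[OF linear_cmat[THEN linear_conv_bounded_linear[THEN iffD1]]] assms)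

lemma W_cancel: "W z ** U z = mat 1 \<Longrightarrow> W z ** (U z ** M) = M"
  by (simp add: matrix_mul_assoc)

lemma pullback_from_Q:
  assumes "W z ** U z = mat 1"
  shows "ctranspose (U z) ** (Q \<Lambda> z - mat 1) ** U z = pullback A B \<Lambda> z"
proof -
  have "ctranspose (U z) ** ctranspose (W z) = mat 1"
    by (simp add: ctranspose_mult[symmetric] assms ctranspose_mat)
  moreover have "ctranspose (U z) ** (Q \<Lambda> z - mat 1) ** U z
      = (ctranspose (U z) ** ctranspose (W z)) ** pullback A B \<Lambda> z ** (W z ** U z)"
    by (simp add: Q_eq matrix_mul_assoc)
  ultimately show ?thesis by (simp add: assms)
qed

lemma measurable_Q: "Q \<Lambda> \<in> borel_measurable circle_measure"
proof -
  have "(\<lambda>z. mat 1 + ctranspose (W z) ** pullback A B \<Lambda> z ** W z) \<in> borel_measurable circle_measure"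
    by (intro borel_measurable_add borel_measurable_const borel_measurable_matrix_mult
        borel_measurable_ctranspose W continuous_imp_measurable_circle[OF continuous_on_pullback[OF stable]])
  then show ?thesis by (simp add: Q_eq[abs_def])
qed

lemma measurable_loss: "loss \<Lambda> \<in> borel_measurable circle_measure"
proof -
  have [measurable]: "(\<lambda>z. det (Q \<Lambda> z)) \<in> borel_measurable circle_measure"
    by (rule borel_measurable_det[OF measurable_Q])
  show ?thesis by measurable
qed

lemma Q_bounded:
  obtains C where "C \<ge> 0" "\<And>\<Lambda>. AE z in circle_measure. norm (Q \<Lambda> z) \<le> C * (1 + norm \<Lambda>)"
proof -
  obtain k where "k > 0" and k: "\<And>(X :: complex^'m^'n) (Y :: complex^'m^'m). norm (X ** Y) \<le> norm X * norm Y * k"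
    using bounded_bilinear.pos_bounded[OF bounded_bilinear_matrix_mult] by blast
  obtain k' where "k' > 0" and k': "\<And>(X :: complex^'n^'m) (Y :: complex^'m^'n). norm (X ** Y) \<le> norm X * norm Y * k'"
    using bounded_bilinear.pos_bounded[OF bounded_bilinear_matrix_mult] by blast
  obtain k'' where "k'' > 0" and k'': "\<And>(X :: complex^'n^'n) (Y :: complex^'m^'n). norm (X ** Y) \<le> norm X * norm Y * k''"
    using bounded_bilinear.pos_bounded[OF bounded_bilinear_matrix_mult] by blast
  obtain g where "g \<ge> 0" and g: "\<And>z. norm z = 1 \<Longrightarrow> norm (transfer_fn A B z) \<le> g"
    using continuous_imp_bounded_circle[OF continuous_on_transfer_fn[OF stable]] by blast
  define c where "c = g * K * k"
  have "c \<ge> 0" using \<open>g \<ge> 0\<close> \<open>k > 0\<close> K_nonneg by (simp add: c_def)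
  define C where "C = norm (mat 1 :: complex^'m^'m) + c * c * k'' * k'"
  have "C \<ge> 0" using \<open>k' > 0\<close> \<open>k'' > 0\<close> \<open>c \<ge> 0\<close> by (simp add: C_def)
  moreover have "AE z in circle_measure. norm (Q \<Lambda> z) \<le> C * (1 + norm \<Lambda>)" for \<Lambda>
    using W(2) AE_norm_1
  proof eventually_elim
    case (elim z)
    define X where "X = transfer_fn A B z ** W z"
    have "norm X \<le> norm (transfer_fn A B z) * norm (W z) * k" unfolding X_def by (rule k)
    also have "\<dots> \<le> c" unfolding c_def
      using elim g[OF elim(2)] \<open>k > 0\<close> \<open>g \<ge> 0\<close> by (intro mult_right_mono mult_mono) auto
    finally have X: "norm X \<le> c" .
    have cmat_norm: "norm (cmat \<Lambda>) = norm \<Lambda>" by (simp add: norm_eq_sqrt_inner cmat_inner)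
    have "norm (ctranspose X ** (cmat \<Lambda> ** X)) \<le> norm X * norm (cmat \<Lambda> ** X) * k'"
      using k'[of "ctranspose X"] by (simp add: norm_ctranspose)
    also have "\<dots> \<le> norm X * (norm \<Lambda> * norm X * k'') * k'"
      using k''[of "cmat \<Lambda>" X] \<open>k' > 0\<close> by (intro mult_right_mono mult_left_mono) (auto simp: cmat_norm)
    also have "\<dots> \<le> c * (norm \<Lambda> * c * k'') * k'"
      using X \<open>k' > 0\<close> \<open>k'' > 0\<close> \<open>c \<ge> 0\<close> by (intro mult_right_mono mult_mono) auto
    finally have 1: "norm (ctranspose X ** cmat \<Lambda> ** X) \<le> (c * c * k'' * k') * norm \<Lambda>"
      by (simp add: matrix_mul_assoc mult_ac)
    have "Q \<Lambda> z = mat 1 + ctranspose X ** cmat \<Lambda> ** X"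
      by (simp add: dual_matrix_def Let_def X_def)
    then have "norm (Q \<Lambda> z) \<le> norm (mat 1 :: complex^'m^'m) + norm (ctranspose X ** cmat \<Lambda> ** X)"
      by (simp add: norm_triangle_ineq)
    also have "\<dots> \<le> norm (mat 1 :: complex^'m^'m) + (c * c * k'' * k') * norm \<Lambda>" using 1 by simp
    also have "\<dots> \<le> C * (1 + norm \<Lambda>)"
      using \<open>k' > 0\<close> \<open>k'' > 0\<close> \<open>c \<ge> 0\<close> by (simp add: C_def algebra_simps)
    finally show ?case .
  qed
  ultimately show ?thesis using that by blast
qed

text \<open>One lower bound serves all \<open>\<Lambda>\<close> in a ball, as Fatou's lemma along a sequence requires.\<close>
lemma loss_bounded_below:
  obtains C where "C \<ge> 0"
    "\<And>\<Lambda>. norm \<Lambda> \<le> R \<Longrightarrow> AE z in circle_measure. posdef (Q \<Lambda> z) \<longrightarrow> - C \<le> loss \<Lambda> z"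
proof -
  obtain c where c: "\<And>M :: complex^'m^'m. posdef M \<Longrightarrow> ln (Re (det M)) \<le> c + 1 * norm M"
    using ln_det_le_norm[of 1] by auto
  obtain q where "q \<ge> 0" and q: "\<And>\<Lambda>. AE z in circle_measure. norm (Q \<Lambda> z) \<le> q * (1 + norm \<Lambda>)"
    using Q_bounded by blast
  define N where "N = norm (mat 1 :: real^'n^'n)"
  define C where "C = max 0 (N * R + c + q * (1 + R))"
  have "AE z in circle_measure. posdef (Q \<Lambda> z) \<longrightarrow> - C \<le> loss \<Lambda> z" if "norm \<Lambda> \<le> R" for \<Lambda>
    using q[of \<Lambda>]
  proof eventually_elim
    case (elim z)
    have "trace \<Lambda> = mat 1 \<bullet> \<Lambda>"
      by (simp add: trace_def inner_vec_def mat_def if_distrib if_distribR cong: if_cong)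
    then have "\<bar>trace \<Lambda>\<bar> \<le> N * norm \<Lambda>" unfolding N_def by (simp add: Cauchy_Schwarz_ineq2)
    also have "\<dots> \<le> N * R" using that by (intro mult_left_mono) (simp_all add: N_def)
    finally have "\<bar>trace \<Lambda>\<bar> \<le> N * R" .
    moreover have "q * (1 + norm \<Lambda>) \<le> q * (1 + R)" using that \<open>q \<ge> 0\<close> by (intro mult_left_mono) auto
    ultimately show ?case using elim c[of "Q \<Lambda> z"] by (auto simp: C_def)
  qed
  then show ?thesis using that[of C] by (simp add: C_def)
qed

lemma dual_set_iff:
  "\<Lambda> \<in> dual_set A B W \<longleftrightarrow> \<Lambda> \<in> range_Gamma A B \<and> (AE z in circle_measure. posdef (Q \<Lambda> z))"
  by (simp add: dual_set_def)

lemma loss_AE_bounded_below: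
  assumes "\<Lambda> \<in> dual_set A B W"
  obtains C where "C \<ge> 0" "AE z in circle_measure. - C \<le> loss \<Lambda> z"
proof -
  obtain C where "C \<ge> 0" and
    below: "\<And>\<Lambda>'. norm \<Lambda>' \<le> norm \<Lambda> \<Longrightarrow> AE z in circle_measure. posdef (Q \<Lambda>' z) \<longrightarrow> - C \<le> loss \<Lambda>' z"
    using loss_bounded_below[of "norm \<Lambda>"] by blast
  have C: "AE z in circle_measure. posdef (Q \<Lambda> z) \<longrightarrow> - C \<le> loss \<Lambda> z"
    by (rule below) simp
  have "AE z in circle_measure. posdef (Q \<Lambda> z)" using assms by (simp add: dual_set_iff)
  with C have "AE z in circle_measure. - C \<le> loss \<Lambda> z" by eventually_elim simp
  with \<open>C \<ge> 0\<close> show ?thesis by (rule that)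
qed

lemma dual_fun_eq_integral:
  assumes "\<Lambda> \<in> dual_set A B W" "dual_fun A B W \<Lambda> \<noteq> \<infinity>"
  shows "integrable circle_measure (loss \<Lambda>)"
    and "dual_fun A B W \<Lambda> = ereal (LINT z|circle_measure. loss \<Lambda> z)"
proof -
  obtain C where C: "C \<ge> 0" "AE z in circle_measure. - C \<le> loss \<Lambda> z"
    using loss_AE_bounded_below[OF assms(1)] .
  show "integrable circle_measure (loss \<Lambda>)"
    by (rule ext_integral_finite_imp_integrable[OF measurable_loss C]) (use assms(2) in \<open>simp add: dual_fun_def\<close>)
  then show "dual_fun A B W \<Lambda> = ereal (LINT z|circle_measure. loss \<Lambda> z)"
    by (simp add: dual_fun_def ext_integral_integrable)
qed

lemma zero_in_dual_set: "0 \<in> dual_set A B W" and dual_fun_zero: "dual_fun A B W 0 = 0"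
proof -
  have Q0: "Q 0 z = mat 1" for z
    by (simp add: Q_eq pullback_def linear_0[OF linear_cmat])
  show "0 \<in> dual_set A B W"
    using subspace_0[OF subspace_range_Gamma[OF stable]] by (simp add: dual_set_iff Q0 posdef_mat_1)
  show "dual_fun A B W 0 = 0"
    by (simp add: dual_fun_def Q0 trace_def ext_integral_def zero_ennreal.rep_eq)
qed

text \<open>The trace of \<open>(U V)\<^sup>* Q (U V)\<close>, written as an inner product of matrices.\<close>
abbreviation energy :: "real^'n^'n \<Rightarrow> complex \<Rightarrow> real" where
  "energy \<Lambda> z \<equiv> (U z ** V z) \<bullet> (Q \<Lambda> z ** (U z ** V z))"

text \<open>As \<open>G W U V = G V\<close>, the spectral factor cancels.\<close>
lemma energy_eq:
  assumes "W z ** U z = mat 1"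
  shows "energy \<Lambda> z = (U z ** V z) \<bullet> (U z ** V z)
    + cmat \<Lambda> \<bullet> ((transfer_fn A B z ** V z) ** ctranspose (transfer_fn A B z ** V z))"
proof -
  let ?G = "transfer_fn A B z"
  have "(U z ** V z) \<bullet> (ctranspose (W z) ** pullback A B \<Lambda> z ** W z ** (U z ** V z))
      = (U z ** V z) \<bullet> (ctranspose (W z) ** (pullback A B \<Lambda> z ** V z))"
    by (simp add: matrix_mul_assoc[symmetric] W_cancel[OF assms])
  also have "\<dots> = V z \<bullet> (pullback A B \<Lambda> z ** V z)"
    by (subst inner_matrix_mult_left) (simp add: W_cancel[OF assms])
  also have "\<dots> = V z \<bullet> (ctranspose ?G ** (cmat \<Lambda> ** (?G ** V z)))"
    by (simp add: pullback_def matrix_mul_assoc)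
  also have "\<dots> = (?G ** V z) \<bullet> (cmat \<Lambda> ** (?G ** V z))"
    by (subst inner_matrix_mult_left) simp
  also have "\<dots> = cmat \<Lambda> \<bullet> ((?G ** V z) ** ctranspose (?G ** V z))"
    unfolding inner_matrix_mult_right[of "cmat \<Lambda>"] by (simp add: inner_commute)
  finally show ?thesis
    by (simp add: Q_eq matrix_add_rdistrib inner_add_right)
qed

text \<open>The covariance of \<open>V V\<^sup>*\<close> is \<open>I\<close>, so the second summand of the energy integrates to \<open>tr \<Lambda>\<close>.\<close>
lemma energy_integral:
  shows "integrable circle_measure (energy \<Lambda>)"
    and "(LINT z|circle_measure. energy \<Lambda> z)
      = trace \<Lambda> + (LINT z|circle_measure. (norm (U z ** V z))\<^sup>2)"
proof -
  let ?X = "\<lambda>z. (transfer_fn A B z ** V z) ** ctranspose (transfer_fn A B z ** V z)"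
  have contX: "continuous_on (sphere 0 1) ?X"
    by (intro continuous_on_matrix_mult continuous_on_ctranspose continuous_on_transfer_fn stable V)
  have intX: "integrable circle_measure ?X" by (rule continuous_imp_integrable_circle[OF contX])
  have measUV: "(\<lambda>z. U z ** V z) \<in> borel_measurable circle_measure"
    by (intro borel_measurable_matrix_mult U continuous_imp_measurable_circle V)
  obtain k where "k > 0" and k: "\<And>(X :: complex^'m^'m) (Y :: complex^'n^'m). norm (X ** Y) \<le> norm X * norm Y * k"
    using bounded_bilinear.pos_bounded[OF bounded_bilinear_matrix_mult] by blast
  obtain v where "v \<ge> 0" and v: "\<And>z. norm z = 1 \<Longrightarrow> norm (V z) \<le> v"
    using continuous_imp_bounded_circle[OF V] by blast
  have intUV: "integrable circle_measure (\<lambda>z. (norm (U z ** V z))\<^sup>2)"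
  proof (rule circle.integrable_const_bound)
    show "AE z in circle_measure. norm ((norm (U z ** V z))\<^sup>2) \<le> (K * v * k)\<^sup>2"
      using U(2) AE_norm_1
    proof eventually_elim
      case (elim z)
      have "norm (U z ** V z) \<le> norm (U z) * norm (V z) * k" by (rule k)
      also have "\<dots> \<le> K * v * k"
        using elim v[OF elim(2)] \<open>k > 0\<close> K_nonneg by (intro mult_right_mono mult_mono) auto
      finally show ?case by (simp add: power_mono)
    qed
  qed (use measUV in measurable)
  have AE: "AE z in circle_measure. (norm (U z ** V z))\<^sup>2 + cmat \<Lambda> \<bullet> ?X z = energy \<Lambda> z"
    using WU by eventually_elim (simp add: energy_eq power2_norm_eq_inner)
  have meas: "energy \<Lambda> \<in> borel_measurable circle_measure"
    using measUV borel_measurable_matrix_mult[OF measurable_Q measUV] by (rule borel_measurable_inner)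
  have int: "integrable circle_measure (\<lambda>z. (norm (U z ** V z))\<^sup>2 + cmat \<Lambda> \<bullet> ?X z)"
    using intUV intX by simp
  show "integrable circle_measure (energy \<Lambda>)"
    by (rule integrable_cong_AE_imp[OF int meas AE])
  have "(LINT z|circle_measure. energy \<Lambda> z) = (LINT z|circle_measure. (norm (U z ** V z))\<^sup>2 + cmat \<Lambda> \<bullet> ?X z)"
    using AE by (intro integral_cong_AE meas borel_measurable_integrable[OF int]) (auto elim: eventually_mono)
  also have "\<dots> = (LINT z|circle_measure. (norm (U z ** V z))\<^sup>2) + cmat \<Lambda> \<bullet> (LINT z|circle_measure. ?X z)"
    using intUV intX by simp
  also have "cmat \<Lambda> \<bullet> (LINT z|circle_measure. ?X z) = trace \<Lambda>"
    unfolding identity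
    by (simp add: trace_def inner_vec_def mat_def inner_complex_def if_distrib if_distribR cong: if_cong)
  finally show "(LINT z|circle_measure. energy \<Lambda> z)
      = trace \<Lambda> + (LINT z|circle_measure. (norm (U z ** V z))\<^sup>2)" by simp
qed

text \<open>\<open>Y W\<close> is a bounded right inverse of \<open>U V\<close>.\<close>
lemma Q_le_energy:
  obtains c where "c > 0"
    "AE z in circle_measure. \<forall>\<Lambda>. posdef (Q \<Lambda> z) \<longrightarrow> norm (Q \<Lambda> z) \<le> c * energy \<Lambda> z"
proof -
  obtain k where "k > 0" and k: "\<And>(X :: complex^'m^'n) (Y :: complex^'m^'m). norm (X ** Y) \<le> norm X * norm Y * k"
    using bounded_bilinear.pos_bounded[OF bounded_bilinear_matrix_mult] by blast
  obtain y where "y \<ge> 0" and y: "\<And>z. norm z = 1 \<Longrightarrow> norm (Y z) \<le> y"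
    using continuous_imp_bounded_circle[OF Y] by blast
  obtain c where "c \<ge> 0" and c: "\<And>(M :: complex^'m^'m) (X :: complex^'n^'m) Z. posdef M \<Longrightarrow> X ** Z = mat 1 \<Longrightarrow>
       norm M \<le> c * (norm Z)\<^sup>2 * (X \<bullet> (M ** X))"
    using norm_posdef_le by blast
  \<comment> \<open>The summand 1 keeps the constant positive.\<close>
  define d where "d = c * (y * K * k)\<^sup>2 + 1"
  have "AE z in circle_measure. \<forall>\<Lambda>. posdef (Q \<Lambda> z) \<longrightarrow> norm (Q \<Lambda> z) \<le> d * energy \<Lambda> z"
    using W(2) WU AE_norm_1
  proof eventually_elim
    case (elim z)
    have "norm (Y z ** W z) \<le> norm (Y z) * norm (W z) * k" by (rule k)
    also have "\<dots> \<le> y * K * k"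
      using elim(1) y[OF elim(3)] \<open>k > 0\<close> \<open>y \<ge> 0\<close> by (intro mult_right_mono mult_mono) auto
    finally have "c * (norm (Y z ** W z))\<^sup>2 \<le> d"
      unfolding d_def using \<open>c \<ge> 0\<close> by (simp add: add_increasing2 mult_left_mono power_mono)
    moreover have UVYW: "(U z ** V z) ** (Y z ** W z) = mat 1"
    proof -
      have "(U z ** V z) ** (Y z ** W z) = U z ** (V z ** Y z) ** W z" by (simp add: matrix_mul_assoc)
      also have "\<dots> = U z ** W z" using VY[OF elim(3)] by simp
      also have "\<dots> = mat 1" using elim(2) by (rule matrix_left_right_inverse[THEN iffD1])
      finally show ?thesis .
    qed
    moreover have "0 \<le> energy \<Lambda> z" if posdef: "posdef (Q \<Lambda> z)" for \<Lambda>
    proof -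
      obtain F :: "complex^'m^'m" where F: "Q \<Lambda> z = ctranspose F ** F"
        by (rule posdef_factorization[OF posdef])
      have "energy \<Lambda> z = (F ** (U z ** V z)) \<bullet> (F ** (U z ** V z))"
        unfolding F matrix_mul_assoc[symmetric] by (subst inner_matrix_mult_left) simp
      then show ?thesis by simp
    qed
    ultimately show ?case by (meson c mult_right_mono order_trans)
  qed
  moreover have "d > 0" using \<open>c \<ge> 0\<close> by (simp add: d_def add_nonneg_pos)
  ultimately show ?thesis using that by blast
qed

text \<open>Half of the energy absorbs \<open>log det Q\<close>, which leaves \<open>tr \<Lambda> / 2\<close> up to a constant.  The
  energy also bounds \<open>G\<^sup>* \<Lambda> G = U\<^sup>* (Q - I) U\<close>, so \<open>tr \<Lambda>\<close> in turn dominates the norm of \<open>\<Lambda>\<close> on the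
  range of \<open>\<Gamma>\<close>.\<close>
lemma dual_fun_coercive:
  obtains a b where "a > 0" "\<And>\<Lambda>. \<Lambda> \<in> dual_set A B W \<Longrightarrow> ereal (a * norm \<Lambda> - b) \<le> dual_fun A B W \<Lambda>"
proof -
  obtain c where "c > 0" and c: "AE z in circle_measure. \<forall>\<Lambda>. posdef (Q \<Lambda> z) \<longrightarrow> norm (Q \<Lambda> z) \<le> c * energy \<Lambda> z"
    using Q_le_energy .
  obtain l where l: "\<And>M :: complex^'m^'m. posdef M \<Longrightarrow> ln (Re (det M)) \<le> l + 1 / (2 * c) * norm M"
    using ln_det_le_norm[of "1 / (2 * c)"] \<open>c > 0\<close> by auto
  obtain k where "k > 0" and k: "\<And>(X :: complex^'m^'m) (Y :: complex^'m^'m). norm (X ** Y) \<le> norm X * norm Y * k"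
    using bounded_bilinear.pos_bounded[OF bounded_bilinear_matrix_mult] by blast
  obtain r where "r > 0" and r: "\<And>\<Lambda>. \<Lambda> \<in> range_Gamma A B \<Longrightarrow>
      norm \<Lambda> \<le> r * (LINT z|circle_measure. norm (pullback A B \<Lambda> z))"
    using range_Gamma_norm_le[OF stable] by blast
  define e where "e = (LINT z|circle_measure. (norm (U z ** V z))\<^sup>2)"
  define N where "N = norm (mat 1 :: complex^'m^'m)"
  define s where "s = (K * k)\<^sup>2"
  have "s \<ge> 0" by (simp add: s_def)
  \<comment> \<open>Chosen so that \<open>tr \<Lambda>\<close> enters \<open>a \<parallel>\<Lambda>\<parallel>\<close> with the factor 1/2.\<close>
  define a where "a = 1 / (2 * (r * (s + 1) * c))"
  define b where "b = (r * (s + 1) * (c * e + N)) * a + l + e / 2"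
  have "a > 0" using \<open>c > 0\<close> \<open>r > 0\<close> \<open>s \<ge> 0\<close> by (simp add: a_def)
  moreover have "ereal (a * norm \<Lambda> - b) \<le> dual_fun A B W \<Lambda>" if \<Lambda>: "\<Lambda> \<in> dual_set A B W" for \<Lambda>
  proof (cases "dual_fun A B W \<Lambda> = \<infinity>")
    case False
    note int = dual_fun_eq_integral[OF \<Lambda> False]
    have pos: "AE z in circle_measure. posdef (Q \<Lambda> z)" and range: "\<Lambda> \<in> range_Gamma A B"
      using \<Lambda> by (simp_all add: dual_set_iff)
    have pull: "AE z in circle_measure. norm (pullback A B \<Lambda> z) \<le> (s + 1) * (c * energy \<Lambda> z + N)"
      using pos c U(2) WU
    proof eventually_elim
      case (elim z)
      have n: "norm (Q \<Lambda> z - mat 1) \<le> c * energy \<Lambda> z + N"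
        using elim(1,2) norm_triangle_ineq4[of "Q \<Lambda> z" "mat 1"] by (force simp: N_def)
      have "norm (pullback A B \<Lambda> z) \<le> norm (ctranspose (U z) ** (Q \<Lambda> z - mat 1)) * norm (U z) * k"
        using k[of "ctranspose (U z) ** (Q \<Lambda> z - mat 1)" "U z"] by (simp add: pullback_from_Q[OF elim(4)])
      also have "\<dots> \<le> (norm (U z) * norm (Q \<Lambda> z - mat 1) * k) * norm (U z) * k"
        using k[of "ctranspose (U z)" "Q \<Lambda> z - mat 1"] \<open>k > 0\<close>
        by (intro mult_right_mono) (auto simp: norm_ctranspose)
      also have "\<dots> = (norm (U z) * k)\<^sup>2 * norm (Q \<Lambda> z - mat 1)" by (simp add: power2_eq_square mult_ac)
      also have "\<dots> \<le> s * norm (Q \<Lambda> z - mat 1)"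
        unfolding s_def using elim(3) \<open>k > 0\<close> by (intro mult_right_mono power_mono) auto
      also have "\<dots> \<le> (s + 1) * norm (Q \<Lambda> z - mat 1)" by (simp add: distrib_right)
      also have "\<dots> \<le> (s + 1) * (c * energy \<Lambda> z + N)" using n \<open>s \<ge> 0\<close> by (intro mult_left_mono) auto
      finally show ?case .
    qed
    note iE = energy_integral(1)[of \<Lambda>]
    have "norm \<Lambda> \<le> r * (LINT z|circle_measure. norm (pullback A B \<Lambda> z))" by (rule r[OF range])
    also have "\<dots> \<le> r * (LINT z|circle_measure. (s + 1) * (c * energy \<Lambda> z + N))"
      using \<open>r > 0\<close> iE
      by (intro mult_left_mono integral_mono_AE pull)
         (auto intro!: continuous_imp_integrable_circle continuous_on_norm continuous_on_pullback stable)
    also have "(LINT z|circle_measure. (s + 1) * (c * energy \<Lambda> z + N)) = (s + 1) * (c * (trace \<Lambda> + e) + N)"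
      using iE by (simp add: energy_integral(2) e_def measure_circle_measure)
    finally have "norm \<Lambda> \<le> r * ((s + 1) * (c * (trace \<Lambda> + e) + N))" .
    also have "\<dots> = r * (s + 1) * c * trace \<Lambda> + r * (s + 1) * (c * e + N)"
      by (simp add: algebra_simps)
    finally have "a * norm \<Lambda> \<le> a * (r * (s + 1) * c * trace \<Lambda> + r * (s + 1) * (c * e + N))"
      using \<open>a > 0\<close> by (intro mult_left_mono) auto
    also have "\<dots> = (a * (r * (s + 1) * c)) * trace \<Lambda> + r * (s + 1) * (c * e + N) * a"
      by (simp add: distrib_left mult_ac)
    also have "a * (r * (s + 1) * c) = 1 / 2"
      using \<open>c > 0\<close> \<open>r > 0\<close> \<open>s \<ge> 0\<close> by (simp add: a_def)
    finally have tr: "a * norm \<Lambda> \<le> trace \<Lambda> / 2 + r * (s + 1) * (c * e + N) * a" by simp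
    have "(LINT z|circle_measure. trace \<Lambda> - l - energy \<Lambda> z / 2) \<le> (LINT z|circle_measure. loss \<Lambda> z)"
    proof (rule integral_mono_AE)
      show "AE z in circle_measure. trace \<Lambda> - l - energy \<Lambda> z / 2 \<le> loss \<Lambda> z"
        using pos c
      proof eventually_elim
        case (elim z)
        have "1 / (2 * c) * norm (Q \<Lambda> z) \<le> 1 / (2 * c) * (c * energy \<Lambda> z)"
          using elim \<open>c > 0\<close> by (intro mult_left_mono) auto
        also have "\<dots> = energy \<Lambda> z / 2" using \<open>c > 0\<close> by simp
        finally show ?case using l[OF elim(1)] by simp
      qed
    qed (use int(1) iE in auto)
    also have "(LINT z|circle_measure. trace \<Lambda> - l - energy \<Lambda> z / 2) = trace \<Lambda> / 2 - l - e / 2"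
      using iE by (simp add: energy_integral(2) e_def measure_circle_measure field_simps)
    finally have "a * norm \<Lambda> - b \<le> (LINT z|circle_measure. loss \<Lambda> z)"
      using tr by (simp add: b_def)
    then show ?thesis by (simp add: int(2))
  qed simp
  ultimately show ?thesis using that by blast
qed

end

section \<open>Existence and uniqueness of the minimizer\<close>

lemma tendsto_psd:
  fixes M :: "nat \<Rightarrow> complex^'m^'m"
  assumes lim: "M \<longlonglongrightarrow> L" and psd: "\<And>n. psd (M n)"
  shows "psd L"
  unfolding psd_def hermitian_def
proof (intro conjI allI)
  have "(\<lambda>n. ctranspose (M n)) \<longlonglongrightarrow> ctranspose L"
    by (rule bounded_linear.tendsto[OF bounded_linear_ctranspose lim])
  moreover have "ctranspose (M n) = M n" for n using psd[of n] by (simp add: psd_def hermitian_def)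
  ultimately show "ctranspose L = L" using lim LIMSEQ_unique by simp
  fix v :: "complex^'m"
  have "(\<lambda>n. v \<bullet> (M n *v v)) \<longlonglongrightarrow> v \<bullet> (L *v v)"
    unfolding matrix_vector_mult_def
    by (intro tendsto_inner tendsto_const tendsto_vec_lambda tendsto_sum tendsto_mult tendsto_vec_nth lim)
  then show "0 \<le> v \<bullet> (L *v v)"
    by (rule LIMSEQ_le_const) (use psd in \<open>auto simp: psd_def\<close>)
qed

text \<open>At a singular limit the determinants tend to 0 from above and the integrands to infinity.  The
  value there has to be given explicitly because \<open>ln 0 = 0\<close>.\<close>
lemma minus_ln_det_limit:
  fixes M :: "nat \<Rightarrow> complex^'m^'m"
  assumes lim: "M \<longlonglongrightarrow> L" and pos: "\<And>n. posdef (M n)" and t: "t \<longlonglongrightarrow> (s :: real)"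
  shows "(\<lambda>n. ennreal (t n - ln (Re (det (M n)))))
    \<longlonglongrightarrow> (if posdef L then ennreal (s - ln (Re (det L))) else top)"
proof -
  have "(\<lambda>n. det (M n)) \<longlonglongrightarrow> det L"
    unfolding det_def by (intro tendsto_sum tendsto_mult tendsto_const tendsto_prod tendsto_vec_nth lim)
  then have det: "(\<lambda>n. Re (det (M n))) \<longlonglongrightarrow> Re (det L)" by (rule tendsto_Re)
  have pos_det: "Re (det (M n)) > 0" for n using det_posdef(1)[OF pos] .
  show ?thesis
  proof (cases "posdef L")
    case True
    then have "Re (det L) \<noteq> 0" using det_posdef(1)[of L] by simp
    then show ?thesis using True
      by (simp add: tendsto_intros det t)
  next
    case False
    have "psd L" by (rule tendsto_psd[OF lim posdef_imp_psd[OF pos]])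
    then have "det L = 0" using False psd_imp_posdef by blast
    then have "filterlim (\<lambda>n. Re (det (M n))) (at_right 0) sequentially"
      using det pos_det by (intro filterlim_at_withinI) (auto intro!: always_eventually simp: less_imp_neq[symmetric])
    then have "filterlim (\<lambda>n. ln (Re (det (M n)))) at_bot sequentially"
      by (rule filterlim_compose[OF ln_at_0])
    then have "filterlim (\<lambda>n. - ln (Re (det (M n)))) at_top sequentially"
      by (simp add: filterlim_uminus_at_top[symmetric] filterlim_uminus_at_bot)
    then have "filterlim (\<lambda>n. t n + - ln (Re (det (M n)))) at_top sequentially"
      by (rule filterlim_tendsto_add_at_top[OF t])
    then show ?thesis using False by (simp add: ennreal_tendsto_top_eq_at_top)
  qed
qed

context dual_problem
begin

text \<open>Fatou's lemma bounds the integral of the lower limit \<open>u\<close> of the shifted integrands.  Its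
  finiteness makes \<open>u\<close> finite almost everywhere, which rules out singular limits.\<close>
lemma dual_fun_lower_semicontinuous:
  assumes X: "\<And>n. X n \<in> dual_set A B W" and lim: "X \<longlonglongrightarrow> \<Lambda>" and range: "\<Lambda> \<in> range_Gamma A B"
    and J: "(\<lambda>n. dual_fun A B W (X n)) \<longlonglongrightarrow> \<mu>" and "\<mu> \<noteq> \<infinity>"
  shows "\<Lambda> \<in> dual_set A B W" and "dual_fun A B W \<Lambda> \<le> \<mu>"
proof -
  have "bounded (range X)" using lim by (rule convergent_imp_bounded)
  then obtain R where R: "\<And>n. norm (X n) \<le> R" by (auto simp: bounded_iff)
  obtain C where "C \<ge> 0" and
    C: "\<And>\<Lambda>. norm \<Lambda> \<le> R \<Longrightarrow> AE z in circle_measure. posdef (Q \<Lambda> z) \<longrightarrow> - C \<le> loss \<Lambda> z"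
    using loss_bounded_below[of R] by blast
  define S where "S n = (\<integral>\<^sup>+z. ennreal (loss (X n) z + C) \<partial>circle_measure)" for n
  have pos: "AE z in circle_measure. posdef (Q (X n) z)" for n using X by (simp add: dual_set_iff)
  have shift: "enn2ereal (S n) = dual_fun A B W (X n) + ereal C" for n
  proof -
    have "AE z in circle_measure. - C \<le> loss (X n) z"
      using pos[of n] C[OF R[of n]] by eventually_elim simp
    from ext_integral_shift[OF measurable_loss \<open>C \<ge> 0\<close> this]
    show ?thesis by (simp add: S_def dual_fun_def)
  qed
  define u where "u z = liminf (\<lambda>n. ennreal (loss (X n) z + C))" for z
  have [measurable]: "loss \<Lambda>' \<in> borel_measurable circle_measure" for \<Lambda>' by (rule measurable_loss)
  have u_meas: "u \<in> borel_measurable circle_measure" unfolding u_def by measurable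
  have tr: "(\<lambda>n. trace (X n) + C) \<longlonglongrightarrow> trace \<Lambda> + C"
    unfolding trace_def by (intro tendsto_intros lim)
  have u: "AE z in circle_measure. u z = (if posdef (Q \<Lambda> z) then ennreal (loss \<Lambda> z + C) else top)"
  proof -
    have "AE z in circle_measure. \<forall>n. posdef (Q (X n) z)" using pos by (simp add: AE_all_countable)
    then show ?thesis
    proof eventually_elim
      case (elim z)
      have "(\<lambda>n. ennreal ((trace (X n) + C) - ln (Re (det (Q (X n) z)))))
          \<longlonglongrightarrow> (if posdef (Q \<Lambda> z) then ennreal ((trace \<Lambda> + C) - ln (Re (det (Q \<Lambda> z)))) else top)"
        by (rule minus_ln_det_limit[OF tendsto_Q[OF lim] _ tr]) (use elim in simp)
      from lim_imp_Liminf[OF sequentially_bot this]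
      show ?case by (simp add: u_def algebra_simps)
    qed
  qed
  have conv: "(\<lambda>n. enn2ereal (S n)) \<longlonglongrightarrow> \<mu> + ereal C"
    unfolding shift by (intro tendsto_add_ereal_general J) (auto intro: tendsto_const)
  then have nonneg: "0 \<le> \<mu> + ereal C"
    by (rule LIMSEQ_le_const) simp
  have "S \<longlonglongrightarrow> e2ennreal (\<mu> + ereal C)"
    using tendsto_e2ennrealI[OF conv] by simp
  then have "liminf S = e2ennreal (\<mu> + ereal C)" by (intro lim_imp_Liminf) simp
  moreover have "(\<integral>\<^sup>+z. u z \<partial>circle_measure) \<le> liminf S"
    unfolding u_def S_def by (rule nn_integral_liminf) measurable
  ultimately have "(\<integral>\<^sup>+z. u z \<partial>circle_measure) \<le> e2ennreal (\<mu> + ereal C)" by simp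
  then have "enn2ereal (\<integral>\<^sup>+z. u z \<partial>circle_measure) \<le> enn2ereal (e2ennreal (\<mu> + ereal C))"
    by (simp add: less_eq_ennreal.rep_eq)
  then have le: "enn2ereal (\<integral>\<^sup>+z. u z \<partial>circle_measure) \<le> \<mu> + ereal C"
    by (simp add: enn2ereal_e2ennreal[OF nonneg])
  then have "(\<integral>\<^sup>+z. u z \<partial>circle_measure) \<noteq> \<infinity>"
    using \<open>\<mu> \<noteq> \<infinity>\<close> by auto
  with u_meas have "AE z in circle_measure. u z \<noteq> \<infinity>" by (rule nn_integral_PInf_AE)
  with u have pos\<Lambda>: "AE z in circle_measure. posdef (Q \<Lambda> z)"
    by eventually_elim (auto split: if_splits)
  then show \<Lambda>: "\<Lambda> \<in> dual_set A B W" using range by (simp add: dual_set_iff)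
  have "(\<integral>\<^sup>+z. u z \<partial>circle_measure) = (\<integral>\<^sup>+z. ennreal (loss \<Lambda> z + C) \<partial>circle_measure)"
    by (rule nn_integral_cong_AE) (use u pos\<Lambda> in \<open>eventually_elim, simp\<close>)
  moreover have "AE z in circle_measure. - C \<le> loss \<Lambda> z"
  proof -
    have "norm \<Lambda> \<le> R" by (rule LIMSEQ_le_const2[OF tendsto_norm[OF lim]]) (use R in auto)
    from C[OF this] pos\<Lambda> show ?thesis by eventually_elim simp
  qed
  from ext_integral_shift[OF measurable_loss \<open>C \<ge> 0\<close> this]
  have "dual_fun A B W \<Lambda> + ereal C = enn2ereal (\<integral>\<^sup>+z. ennreal (loss \<Lambda> z + C) \<partial>circle_measure)"
    by (simp add: dual_fun_def)
  ultimately have "dual_fun A B W \<Lambda> + ereal C \<le> \<mu> + ereal C" using le by simp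
  then show "dual_fun A B W \<Lambda> \<le> \<mu>" by (simp add: ereal_add_le_add_iff2)
qed

lemma minimizer_exists:
  "\<exists>\<Lambda>\<in>dual_set A B W. \<forall>\<Lambda>'\<in>dual_set A B W. dual_fun A B W \<Lambda> \<le> dual_fun A B W \<Lambda>'"
proof -
  define \<mu> where "\<mu> = Inf (dual_fun A B W ` dual_set A B W)"
  have "\<exists>u. (\<forall>n. u n \<in> dual_fun A B W ` dual_set A B W) \<and> u \<longlonglongrightarrow> \<mu>"
    unfolding \<mu>_def by (rule Inf_as_limit) (use zero_in_dual_set in auto)
  then obtain u where u: "\<And>n. u n \<in> dual_fun A B W ` dual_set A B W" "u \<longlonglongrightarrow> \<mu>" by blast
  then have "\<forall>n. \<exists>X\<in>dual_set A B W. u n = dual_fun A B W X" by blast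
  then obtain X where X: "\<And>n. X n \<in> dual_set A B W" and uX: "\<And>n. u n = dual_fun A B W (X n)" by metis
  have "\<mu> \<le> 0"
    unfolding \<mu>_def using Inf_lower[OF imageI[OF zero_in_dual_set], of "dual_fun A B W"] by (simp add: dual_fun_zero)
  then have "\<mu> < 1" by (rule le_less_trans) simp
  then have "\<forall>\<^sub>F n in sequentially. u n < 1" using order_tendstoD(2)[OF u(2)] by blast
  then obtain N where N: "\<And>n. n \<ge> N \<Longrightarrow> u n < 1" by (auto simp: eventually_sequentially)
  obtain a b where "a > 0" and ab: "\<And>\<Lambda>. \<Lambda> \<in> dual_set A B W \<Longrightarrow> ereal (a * norm \<Lambda> - b) \<le> dual_fun A B W \<Lambda>"
    using dual_fun_coercive by blast
  have ball: "X (n + N) \<in> cball 0 ((1 + b) / a)" for n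
  proof -
    have "ereal (a * norm (X (n + N)) - b) < 1"
      using ab[OF X[of "n + N"]] N[of "n + N"] unfolding uX by (rule le_less_trans) simp
    then have "a * norm (X (n + N)) - b < 1" by (simp add: one_ereal_def)
    then show ?thesis using \<open>a > 0\<close> by (simp add: field_simps)
  qed
  have "seq_compact (cball (0 :: real^'n^'n) ((1 + b) / a))"
    by (rule compact_imp_seq_compact) simp
  from seq_compactE[OF this, of "\<lambda>n. X (n + N)"] ball
  obtain \<Lambda> r where r: "strict_mono r" and lim: "((\<lambda>n. X (n + N)) \<circ> r) \<longlonglongrightarrow> \<Lambda>"
    by metis
  have "closed (range_Gamma A B)" by (rule closed_subspace[OF subspace_range_Gamma[OF stable]])
  then have range: "\<Lambda> \<in> range_Gamma A B"
    by (rule closed_sequentially[OF _ _ lim]) (use X in \<open>simp add: dual_set_iff\<close>)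
  have "(\<lambda>n. u (n + N)) \<longlonglongrightarrow> \<mu>" using u(2) by (rule LIMSEQ_ignore_initial_segment)
  then have "((\<lambda>n. u (n + N)) \<circ> r) \<longlonglongrightarrow> \<mu>" using r by (rule LIMSEQ_subseq_LIMSEQ)
  then have J: "(\<lambda>n. dual_fun A B W (((\<lambda>n. X (n + N)) \<circ> r) n)) \<longlonglongrightarrow> \<mu>" by (simp add: o_def uX)
  have "\<mu> \<noteq> \<infinity>" using \<open>\<mu> \<le> 0\<close> by auto
  have "\<Lambda> \<in> dual_set A B W" "dual_fun A B W \<Lambda> \<le> \<mu>"
    by (rule dual_fun_lower_semicontinuous[OF _ lim range J \<open>\<mu> \<noteq> \<infinity>\<close>]; simp add: X)+
  moreover have "\<mu> \<le> dual_fun A B W \<Lambda>'" if "\<Lambda>' \<in> dual_set A B W" for \<Lambda>'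
    unfolding \<mu>_def using that by (intro Inf_lower imageI)
  ultimately show ?thesis using order_trans by blast
qed

text \<open>At the midpoint \<open>M\<close> the functional would be smaller unless the nonnegative convexity gap of the
  integrands vanishes almost everywhere.\<close>
lemma minimizer_unique:
  assumes X: "X \<in> dual_set A B W" "\<And>\<Lambda>. \<Lambda> \<in> dual_set A B W \<Longrightarrow> dual_fun A B W X \<le> dual_fun A B W \<Lambda>"
    and X': "X' \<in> dual_set A B W" "\<And>\<Lambda>. \<Lambda> \<in> dual_set A B W \<Longrightarrow> dual_fun A B W X' \<le> dual_fun A B W \<Lambda>"
  shows "X = X'"
proof -
  define M where "M = (1/2) *\<^sub>R (X + X')"
  have range: "X \<in> range_Gamma A B" "X' \<in> range_Gamma A B"
    and pos: "AE z in circle_measure. posdef (Q X z)" "AE z in circle_measure. posdef (Q X' z)"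
    using X(1) X'(1) by (simp_all add: dual_set_iff)
  note sub = subspace_range_Gamma[OF stable, of B]
  have QM: "Q M z = (1/2) *\<^sub>R (Q X z + Q X' z)" for z unfolding M_def by (rule Q_midpoint)
  have "AE z in circle_measure. posdef (Q M z)"
    using pos by eventually_elim (simp add: QM posdef_midpoint)
  then have M: "M \<in> dual_set A B W"
    unfolding dual_set_iff M_def using range by (auto intro: subspace_scale[OF sub] subspace_add[OF sub])
  have finX: "dual_fun A B W X \<noteq> \<infinity>" and finX': "dual_fun A B W X' \<noteq> \<infinity>"
    using X(2)[OF zero_in_dual_set] X'(2)[OF zero_in_dual_set] by (auto simp: dual_fun_zero)
  note I = dual_fun_eq_integral[OF X(1) finX] and I' = dual_fun_eq_integral[OF X'(1) finX']
  have trM: "2 * trace M = trace X + trace X'"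
  proof -
    have "trace M = (trace X + trace X') / 2"
      by (simp add: M_def trace_def sum.distrib[symmetric] sum_divide_distrib)
    then show ?thesis by simp
  qed
  have convex: "AE z in circle_measure. 2 * loss M z \<le> loss X z + loss X' z"
    using pos
  proof eventually_elim
    case (elim z)
    show ?case using ln_det_midpoint(1)[OF elim] trM by (simp add: QM algebra_simps)
  qed
  have intM: "integrable circle_measure (loss M)"
  proof -
    obtain C where C: "C \<ge> 0" "AE z in circle_measure. - C \<le> loss M z"
      using loss_AE_bounded_below[OF M] .
    have "integrable circle_measure (\<lambda>z. \<bar>loss X z\<bar> + \<bar>loss X' z\<bar> + C)"
      using I(1) I'(1) by (intro Bochner_Integration.integrable_add integrable_abs) simp_all
    then show ?thesis
    proof (rule Bochner_Integration.integrable_bound[OF _ measurable_loss])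
      show "AE z in circle_measure. norm (loss M z) \<le> norm (\<bar>loss X z\<bar> + \<bar>loss X' z\<bar> + C)"
        using convex C(2) by eventually_elim (use \<open>C \<ge> 0\<close> in \<open>simp add: abs_le_iff\<close>; linarith)
    qed
  qed
  define gap where "gap z = loss X z + loss X' z - 2 * loss M z" for z
  have int: "integrable circle_measure gap" unfolding gap_def
    by (intro Bochner_Integration.integrable_diff Bochner_Integration.integrable_add integrable_mult_right I(1) I'(1) intM)
  have nonneg: "AE z in circle_measure. 0 \<le> gap z"
    using convex by eventually_elim (simp add: gap_def)
  have JM: "dual_fun A B W M = ereal (LINT z|circle_measure. loss M z)"
    using intM by (simp add: dual_fun_def ext_integral_integrable)
  have "(LINT z|circle_measure. gap z) = (LINT z|circle_measure. loss X z)
      + (LINT z|circle_measure. loss X' z) - 2 * (LINT z|circle_measure. loss M z)"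
    unfolding gap_def
    by (simp only: Bochner_Integration.integral_diff Bochner_Integration.integral_add integral_mult_right_zero
        Bochner_Integration.integrable_add integrable_mult_right I(1) I'(1) intM)
  also have "\<dots> \<le> 0"
    using X(2)[OF M] X'(2)[OF M] by (simp add: I(2) I'(2) JM)
  finally have "(LINT z|circle_measure. gap z) = 0"
    using integral_nonneg_AE[OF nonneg] by simp
  then have "AE z in circle_measure. gap z = 0"
    using integral_nonneg_eq_0_iff_AE[OF int nonneg] by simp
  then have "AE z in circle_measure. pullback A B (X - X') z = 0"
    using pos WU
  proof eventually_elim
    case (elim z)
    have "ln (Re (det (Q X z))) + ln (Re (det (Q X' z))) = 2 * ln (Re (det (Q M z)))"
      using elim(1) trM by (simp add: gap_def algebra_simps)
    then have "Q X z = Q X' z" using ln_det_midpoint(2)[OF elim(2,3)] by (simp add: QM)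
    then have "pullback A B X z = pullback A B X' z"
      by (metis pullback_from_Q[OF elim(4)])
    then show ?case by (simp add: pullback_linear)
  qed
  then have "AE z in circle_measure. norm (pullback A B (X - X') z) = 0" by simp
  then have zero: "(LINT z|circle_measure. norm (pullback A B (X - X') z)) = 0" by (rule integral_eq_zero_AE)
  obtain C where "\<And>\<Lambda>. \<Lambda> \<in> range_Gamma A B \<Longrightarrow>
      norm \<Lambda> \<le> C * (LINT z|circle_measure. norm (pullback A B \<Lambda> z))"
    using range_Gamma_norm_le[OF stable, of B] by blast
  from this[OF subspace_diff[OF sub range]] show ?thesis by (simp add: zero)
qed

end

theorem theoremV2:
  fixes A :: "real^'n^'n" and B :: "real^'m^'n"
    and \<Psi> W :: "complex \<Rightarrow> complex^'m^'m"
  assumes "stable_matrix A"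
    and "CARD('m) \<le> CARD('n)"
    and "rank B = CARD('m)"
    and "reachable A B"
    and "bounded_coercive_density \<Psi>"
    and "stable_min_phase_factor W \<Psi>"
    and "\<exists>H :: real^'n^'m. mat 1 - A ** transpose A = B ** H + transpose H ** transpose B"
  shows "\<exists>!\<Lambda>. \<Lambda> \<in> dual_set A B W \<and>
           (\<forall>\<Lambda>'\<in>dual_set A B W. dual_fun A B W \<Lambda> \<le> dual_fun A B W \<Lambda>')"
proof -
  obtain H :: "real^'n^'m" where H: "mat 1 - A ** transpose A = B ** H + transpose H ** transpose B"
    using assms(7) by blast
  obtain V :: "complex \<Rightarrow> complex^'n^'m" and Y where VY: "continuous_on (sphere 0 1) V" "continuous_on (sphere 0 1) Y"
    "\<And>z. norm z = 1 \<Longrightarrow> V z ** Y z = mat 1"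
    "(LINT z|circle_measure. (transfer_fn A B z ** V z) ** ctranspose (transfer_fn A B z ** V z)) = mat 1"
    using maximum_entropy_factor[OF assms(1,3) H] by blast
  define U where "U z = matrix_inv (W z)" for z
  have W: "stable_function W" and U: "stable_function U"
    using assms(6) by (simp_all add: stable_min_phase_factor_def U_def[abs_def])
  obtain k where k: "k \<ge> 0" "AE z in circle_measure. norm (W z) \<le> k"
    using stable_function_bounded[OF W] by blast
  obtain l where l: "l \<ge> 0" "AE z in circle_measure. norm (U z) \<le> l"
    using stable_function_bounded[OF U] by blast
  interpret dual_problem A B W U "k + l" V Y
  proof
    show "AE z in circle_measure. norm (W z) \<le> k + l" using k(2) by eventually_elim (use l(1) in simp)
    show "AE z in circle_measure. norm (U z) \<le> k + l" using l(2) by eventually_elim (use k(1) in simp)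
    show "AE z in circle_measure. W z ** U z = mat 1"
      unfolding U_def by (rule spectral_factor_inverse[OF assms(6)])
  qed (use assms(1) k(1) l(1) VY stable_function_measurable[OF W] stable_function_measurable[OF U] in auto)
  obtain \<Lambda> where "\<Lambda> \<in> dual_set A B W" "\<forall>\<Lambda>'\<in>dual_set A B W. dual_fun A B W \<Lambda> \<le> dual_fun A B W \<Lambda>'"
    using minimizer_exists by blast
  then show ?thesis by (intro ex1I[of _ \<Lambda>]) (auto intro: minimizer_unique)
qed

end
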